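(* Let $\phi,\psi$ be arithmetical sentences. (i) If $p$ is the code of a $U$-proof of $\phi\to\psi$, then $\mathsf{EA}\vdash\forall x\ge\underline{p}\,\forall\chi\le x\,(\blacksquare_{\psi,(x)}\chi\to\blacksquare_{\phi,(x)}\chi)$. (ii) If $p$ is the code of a $U$-proof of $\phi\leftrightarrow\psi$, then $\mathsf{EA}\vdash\forall x\ge\underline{p}\,\forall\chi\le x\,(\blacksquare_{\psi,(x)}\chi\leftrightarrow\blacksquare_{\phi,(x)}\chi)$.
   Context: $\mathsf{EA}=\mathrm{I}\Delta_0+\mathsf{Exp}$; $\underline p$ is the numeral of $p$. $U$ is a consistent arithmetical theory which ($\mathsf{EA}$-verifiably) extends $\mathsf{PA}$, whose axiom set $\mathcal A$ is given by an elementary formula $\alpha$ binumerating it ($U\vdash\alpha(\ulcorner\chi\urcorner)$ if $\chi\in\mathcal A$, $U\vdash\neg\alpha(\ulcorner\chi\urcorner)$ otherwise). $\mathsf{proof}_\phi(p,y)$ is a standard elementary formula saying $p$ is a proof of $y$ all of whose assumptions are $U$-axioms (satisfy $\alpha$) or equal $\phi$; codes of formulas in a proof are smaller than the proof. $\Box_{\phi,(x)}\psi:\leftrightarrow\exists p\le x\,\mathsf{proof}_\phi(p,\ulcorner\psi\urcorner)$. For sentences $\phi,\chi\le n$, $\phi\preceq_n\chi$ means $\chi$ follows by propositional logic from $\phi$ together with the sentences having $U$-proofs with code $\le n$; $\preceq_x$ is its arithmetization. $\blacksquare_{\phi,(x)}\psi:\leftrightarrow\exists\chi\le x\,(\phi\preceq_x\chi\wedge\Box_{\chi,(x)}\psi)$.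 *)

theory Defs
  imports Main "HOL-Library.Nat_Bijection"
begin

section \<open>Syntax\<close>

text \<open>
  First-order arithmetic with equality, in the language \<open>0, S, +, *, 2^x, \<le>\<close>; variables are de Bruijn
  indices. The symbol for exponentiation is part of the language because elementary formulas
  are bounded formulas in which exponential terms may occur. The other connectives are defined.
\<close>

datatype tm =
    Var nat
  | Zero
  | Succ tm
  | Plus tm tm
  | Times tm tm
  | Exp2 tm

datatype fm =
    Eq tm tm
  | Le tm tm
  | Fls
  | Imp fm fm
  | All fm

definition Neg :: "fm \<Rightarrow> fm" where "Neg A = Imp A Fls"
definition Conj :: "fm \<Rightarrow> fm \<Rightarrow> fm" where "Conj A B = Neg (Imp A (Neg B))"
definition Disj :: "fm \<Rightarrow> fm \<Rightarrow> fm" where "Disj A B = Imp (Neg A) B"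
definition Iff :: "fm \<Rightarrow> fm \<Rightarrow> fm" where "Iff A B = Conj (Imp A B) (Imp B A)"
definition Ex :: "fm \<Rightarrow> fm" where "Ex A = Neg (All (Neg A))"

primrec nm :: "nat \<Rightarrow> tm" where
  "nm 0 = Zero"
| "nm (Suc n) = Succ (nm n)"

primrec fv_tm :: "tm \<Rightarrow> nat set" where
  "fv_tm (Var i) = {i}"
| "fv_tm Zero = {}"
| "fv_tm (Succ t) = fv_tm t"
| "fv_tm (Plus s t) = fv_tm s \<union> fv_tm t"
| "fv_tm (Times s t) = fv_tm s \<union> fv_tm t"
| "fv_tm (Exp2 t) = fv_tm t"

primrec fv :: "fm \<Rightarrow> nat set" where
  "fv (Eq s t) = fv_tm s \<union> fv_tm t"
| "fv (Le s t) = fv_tm s \<union> fv_tm t"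
| "fv Fls = {}"
| "fv (Imp A B) = fv A \<union> fv B"
| "fv (All A) = {i. Suc i \<in> fv A}"

definition sentence :: "fm \<Rightarrow> bool" where
  "sentence A \<longleftrightarrow> fv A = {}"

text \<open>Simultaneous capture-avoiding substitution.\<close>

primrec subst_tm :: "(nat \<Rightarrow> tm) \<Rightarrow> tm \<Rightarrow> tm" where
  "subst_tm \<sigma> (Var i) = \<sigma> i"
| "subst_tm \<sigma> Zero = Zero"
| "subst_tm \<sigma> (Succ t) = Succ (subst_tm \<sigma> t)"
| "subst_tm \<sigma> (Plus s t) = Plus (subst_tm \<sigma> s) (subst_tm \<sigma> t)"
| "subst_tm \<sigma> (Times s t) = Times (subst_tm \<sigma> s) (subst_tm \<sigma> t)"
| "subst_tm \<sigma> (Exp2 t) = Exp2 (subst_tm \<sigma> t)"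

definition lift_tm :: "tm \<Rightarrow> tm" where
  "lift_tm = subst_tm (\<lambda>i. Var (Suc i))"

primrec subst :: "(nat \<Rightarrow> tm) \<Rightarrow> fm \<Rightarrow> fm" where
  "subst \<sigma> (Eq s t) = Eq (subst_tm \<sigma> s) (subst_tm \<sigma> t)"
| "subst \<sigma> (Le s t) = Le (subst_tm \<sigma> s) (subst_tm \<sigma> t)"
| "subst \<sigma> Fls = Fls"
| "subst \<sigma> (Imp A B) = Imp (subst \<sigma> A) (subst \<sigma> B)"
| "subst \<sigma> (All A) = All (subst (case_nat (Var 0) (\<lambda>i. lift_tm (\<sigma> i))) A)"

definition lift :: "fm \<Rightarrow> fm" where
  "lift = subst (\<lambda>i. Var (Suc i))"

text \<open>\<open>inst [t\<^sub>0, \<dots>, t\<^sub>k] A\<close> replaces the variables \<open>0, \<dots>, k\<close> by the given terms and lowers all other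
  free variables by \<open>k + 1\<close>; so \<open>inst [t] A\<close> is the instance of \<open>All A\<close> at \<open>t\<close>.\<close>

definition inst :: "tm list \<Rightarrow> fm \<Rightarrow> fm" where
  "inst ts = subst (\<lambda>i. if i < length ts then ts ! i else Var (i - length ts))"

text \<open>Bounded quantifiers. The bound does not contain the quantified variable, hence the lifting.\<close>

definition BAll :: "tm \<Rightarrow> fm \<Rightarrow> fm" where
  "BAll t A = All (Imp (Le (Var 0) (lift_tm t)) A)"

definition BEx :: "tm \<Rightarrow> fm \<Rightarrow> fm" where
  "BEx t A = Neg (BAll t (Neg A))"

inductive elementary :: "fm \<Rightarrow> bool" where
  "elementary (Eq s t)"
| "elementary (Le s t)"
| "elementary Fls"
| "elementary A \<Longrightarrow> elementary B \<Longrightarrow> elementary (Imp A B)"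
| "elementary A \<Longrightarrow> elementary (BAll t A)"

section \<open>Proofs\<close>

text \<open>\<open>A[y/x]\<close> for the variables \<open>x = Var 0\<close> and \<open>y = Var 1\<close>, and the replacement of \<open>Var 0\<close>
  by its successor.\<close>

definition rename_fm :: "fm \<Rightarrow> fm" where
  "rename_fm = subst (case_nat (Var 1) (\<lambda>i. Var (Suc i)))"

definition succ_fm :: "fm \<Rightarrow> fm" where
  "succ_fm = subst (case_nat (Succ (Var 0)) (\<lambda>i. Var (Suc i)))"

inductive_set logical_axioms :: "fm set" where
  "Imp A (Imp B A) \<in> logical_axioms"
| "Imp (Imp A (Imp B C)) (Imp (Imp A B) (Imp A C)) \<in> logical_axioms"
| "Imp (Neg (Neg A)) A \<in> logical_axioms"
| "Imp (All A) (inst [t] A) \<in> logical_axioms"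
| "Imp (All (Imp A B)) (Imp (All A) (All B)) \<in> logical_axioms"
| "Imp A (All (lift A)) \<in> logical_axioms"
| "Eq t t \<in> logical_axioms"
| "Imp (Eq (Var 0) (Var 1)) (Imp A (rename_fm A)) \<in> logical_axioms"

text \<open>A proof from the assumptions \<open>T\<close> is a finite sequence of formulas, with the rules modus ponens
  and generalization. The list has the last formula of the sequence, which is the one proved, at
  its head. Theories and additional assumptions are always sentences, so that generalization is
  harmless.\<close>

primrec derivation :: "fm set \<Rightarrow> fm list \<Rightarrow> bool" where
  "derivation T [] \<longleftrightarrow> True"
| "derivation T (A # ps) \<longleftrightarrow> derivation T ps \<and>
     (A \<in> logical_axioms \<or> A \<in> T \<or> (\<exists>B \<in> set ps. Imp B A \<in> set ps) \<or> (\<exists>B \<in> set ps. A = All B))"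

definition proves :: "fm set \<Rightarrow> fm \<Rightarrow> bool" (infix \<open>\<turnstile>\<close> 50) where
  "T \<turnstile> A \<longleftrightarrow> (\<exists>ps. derivation T (A # ps))"

section \<open>EA and PA\<close>

definition basic_axioms :: "fm list" where
  "basic_axioms = [
     All (Neg (Eq (Succ (Var 0)) Zero)),
     All (All (Imp (Eq (Succ (Var 0)) (Succ (Var 1))) (Eq (Var 0) (Var 1)))),
     All (Eq (Plus (Var 0) Zero) (Var 0)),
     All (All (Eq (Plus (Var 0) (Succ (Var 1))) (Succ (Plus (Var 0) (Var 1))))),
     All (Eq (Times (Var 0) Zero) Zero),
     All (All (Eq (Times (Var 0) (Succ (Var 1))) (Plus (Times (Var 0) (Var 1)) (Var 0)))),
     Eq (Exp2 Zero) (Succ Zero),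
     All (Eq (Exp2 (Succ (Var 0))) (Plus (Exp2 (Var 0)) (Exp2 (Var 0)))),
     All (Iff (Le (Var 0) Zero) (Eq (Var 0) Zero)),
     All (All (Iff (Le (Var 0) (Succ (Var 1))) (Disj (Le (Var 0) (Var 1)) (Eq (Var 0) (Succ (Var 1))))))]"

text \<open>Induction on variable 0; the other free variables of \<open>A\<close> are parameters.\<close>

definition induction_fm :: "fm \<Rightarrow> fm" where
  "induction_fm A =
     Imp (inst [Zero] A)
      (Imp (All (Imp A (succ_fm A))) (All A))"

text \<open>The axioms are sentences: universal closures of induction formulas are taken.\<close>

definition EA :: "fm set" where
  "EA = set basic_axioms \<union>
     {B. sentence B \<and> (\<exists>n A. elementary A \<and> B = (All ^^ n) (induction_fm A))}"

definition PA :: "fm set" where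
  "PA = set basic_axioms \<union> {B. sentence B \<and> (\<exists>n A. B = (All ^^ n) (induction_fm A))}"

section \<open>Goedel numbers\<close>

text \<open>These are bijections; in particular, every number is the code of a formula.\<close>

primrec gn_tm :: "tm \<Rightarrow> nat" where
  "gn_tm Zero = 0"
| "gn_tm (Var i) = 8 * i + 1"
| "gn_tm (Exp2 t) = 8 * gn_tm t + 5"
| "gn_tm (Succ t) = 4 * gn_tm t + 2"
| "gn_tm (Plus s t) = 4 * prod_encode (gn_tm s, gn_tm t) + 3"
| "gn_tm (Times s t) = 4 * prod_encode (gn_tm s, gn_tm t) + 4"

primrec gn :: "fm \<Rightarrow> nat" where
  "gn Fls = 0"
| "gn (Eq s t) = 4 * prod_encode (gn_tm s, gn_tm t) + 1"
| "gn (Le s t) = 4 * prod_encode (gn_tm s, gn_tm t) + 2"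
| "gn (Imp A B) = 4 * prod_encode (gn A, gn B) + 3"
| "gn (All A) = 4 * gn A + 4"

definition quote_fm :: "fm \<Rightarrow> tm" (\<open>\<ulcorner>_\<urcorner>\<close>) where
  "\<ulcorner>A\<urcorner> = nm (gn A)"

definition quote_tm :: "tm \<Rightarrow> tm" (\<open>\<ulcorner>_\<urcorner>\<^sub>t\<close>) where
  "\<ulcorner>t\<urcorner>\<^sub>t = nm (gn_tm t)"

definition codes_proof :: "fm set \<Rightarrow> nat \<Rightarrow> fm \<Rightarrow> bool" where
  "codes_proof T p A \<longleftrightarrow> (\<exists>ps. derivation T (A # ps) \<and> p = list_encode (map gn (A # ps)))"

section \<open>The standard model\<close>

primrec val :: "(nat \<Rightarrow> nat) \<Rightarrow> tm \<Rightarrow> nat" where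
  "val e (Var i) = e i"
| "val e Zero = 0"
| "val e (Succ t) = Suc (val e t)"
| "val e (Plus s t) = val e s + val e t"
| "val e (Times s t) = val e s * val e t"
| "val e (Exp2 t) = 2 ^ val e t"

primrec sat :: "(nat \<Rightarrow> nat) \<Rightarrow> fm \<Rightarrow> bool" where
  "sat e (Eq s t) \<longleftrightarrow> val e s = val e t"
| "sat e (Le s t) \<longleftrightarrow> val e s \<le> val e t"
| "sat e Fls \<longleftrightarrow> False"
| "sat e (Imp A B) \<longleftrightarrow> (sat e A \<longrightarrow> sat e B)"
| "sat e (All A) \<longleftrightarrow> (\<forall>n. sat (case_nat n e) A)"

text \<open>Truth of sentences; the environment is irrelevant.\<close>

definition holds :: "fm \<Rightarrow> bool" where
  "holds A \<longleftrightarrow> sat (\<lambda>_. 0) A"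

section \<open>Arithmetization\<close>

definition binumerates :: "fm set \<Rightarrow> fm \<Rightarrow> fm set \<Rightarrow> bool" where
  "binumerates U \<alpha> X \<longleftrightarrow>
     (\<forall>A. (A \<in> X \<longrightarrow> U \<turnstile> inst [\<ulcorner>A\<urcorner>] \<alpha>) \<and> (A \<notin> X \<longrightarrow> U \<turnstile> Neg (inst [\<ulcorner>A\<urcorner>] \<alpha>)))"

text \<open>
  The formulas below take terms as arguments. An argument used under \<open>n\<close> quantifiers is lifted
  \<open>n\<close> times. The meaning of each formula in the standard model is given by a lemma
  in the last section.
\<close>

abbreviation L :: "nat \<Rightarrow> tm \<Rightarrow> tm" where
  "L n \<equiv> lift_tm ^^ n"

abbreviation Lt :: "tm \<Rightarrow> tm \<Rightarrow> fm" where
  "Lt s t \<equiv> Le (Succ s) t"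

subsection \<open>Coding\<close>

text \<open>\<open>2 * prod_encode (s, t)\<close>, the terms \<open>4 * prod_encode (s, t) + j\<close> and \<open>n * s + j\<close> that occur
  in the definition of \<open>gn\<close>, and \<open>u\<close> being the code of the list with head \<open>s\<close> and tail \<open>t\<close>.\<close>

definition Tup :: "tm \<Rightarrow> tm \<Rightarrow> tm" where
  "Tup s t = Plus (Times (Plus s t) (Succ (Plus s t))) (Plus s s)"

definition Code2 :: "nat \<Rightarrow> tm \<Rightarrow> tm \<Rightarrow> tm" where
  "Code2 j s t = Plus (Plus (Tup s t) (Tup s t)) (nm j)"

definition Code1 :: "nat \<Rightarrow> nat \<Rightarrow> tm \<Rightarrow> tm" where
  "Code1 n j s = Plus (Times (nm n) s) (nm j)"

abbreviation "Eq_code \<equiv> Code2 1"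
abbreviation "Le_code \<equiv> Code2 2"
abbreviation "Imp_code \<equiv> Code2 3"
abbreviation "All_code \<equiv> Code1 4 4"
abbreviation "Var_code \<equiv> Code1 8 1"

definition Is_Cons :: "tm \<Rightarrow> tm \<Rightarrow> tm \<Rightarrow> fm" where
  "Is_Cons u s t = Eq (Plus u u) (Succ (Succ (Tup s t)))"

text \<open>A finite set of numbers is coded by the number with the corresponding binary digits:
  \<open>s \<in> t\<close> iff \<open>t = (2q + 1) 2^s + r\<close> for some \<open>q\<close> and \<open>r < 2^s\<close>. In the matrix, \<open>q\<close> is
  \<open>Var 1\<close> and \<open>r\<close> is \<open>Var 0\<close>.\<close>

definition Mem :: "tm \<Rightarrow> tm \<Rightarrow> fm" where
  "Mem s t = BEx t (BEx (L 1 t)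
     (Conj (Lt (Var 0) (Exp2 (L 2 s)))
       (Eq (L 2 t) (Plus (Times (Succ (Plus (Var 1) (Var 1))) (Exp2 (L 2 s))) (Var 0)))))"

subsection \<open>Substitution\<close>

text \<open>
  All recursively defined relations are expressed by the existence of a finite set that
  contains the tuple in question and each of whose elements is obtained from
  other elements by a clause of the recursion.

  \<open>Tm_map V a b\<close>: the term \<open>b\<close> results from \<open>a\<close> by replacing each variable \<open>i\<close> by a term \<open>d\<close>
  with \<open>V i d\<close>. The formula \<open>V i d\<close> is used under 4 quantifiers. In the clauses, the set
  is \<open>Var 2\<close>, and its element is the pair of \<open>Var 1\<close> and \<open>Var 0\<close>, before further
  quantifiers for the immediate subterms.
\<close>

definition Tm_map :: "(tm \<Rightarrow> tm \<Rightarrow> fm) \<Rightarrow> tm \<Rightarrow> tm \<Rightarrow> fm" where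
  "Tm_map V a b = BEx (Exp2 (Succ (Tup a b)))
     (Conj (Mem (Tup (L 1 a) (L 1 b)) (Var 0))
       (BAll (L 1 a) (BAll (L 2 b) (Imp (Mem (Tup (Var 1) (Var 0)) (Var 2))
         (Disj (Conj (Eq (Var 1) Zero) (Eq (Var 0) Zero))
         (Disj (BEx (Var 1) (Conj (Eq (Var 2) (Var_code (Var 0))) (V (Var 0) (Var 1))))
         (Disj
           (BEx (Var 1) (BEx (Var 1) (Conj (Mem (Tup (Var 1) (Var 0)) (Var 4))
             (Disj (Conj (Eq (Var 3) (Code1 4 2 (Var 1))) (Eq (Var 2) (Code1 4 2 (Var 0))))
                   (Conj (Eq (Var 3) (Code1 8 5 (Var 1))) (Eq (Var 2) (Code1 8 5 (Var 0))))))))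
           (BEx (Var 1) (BEx (Var 2) (BEx (Var 2) (BEx (Var 3)
             (Conj (Conj (Mem (Tup (Var 3) (Var 1)) (Var 6)) (Mem (Tup (Var 2) (Var 0)) (Var 6)))
               (Disj
                 (Conj (Eq (Var 5) (Code2 3 (Var 3) (Var 2))) (Eq (Var 4) (Code2 3 (Var 1) (Var 0))))
                 (Conj (Eq (Var 5) (Code2 4 (Var 3) (Var 2))) (Eq (Var 4) (Code2 4 (Var 1) (Var 0)))))))))))))))))"

text \<open>\<open>b\<close> results from the term \<open>a\<close> by adding \<open>k\<close> to all variables.\<close>

definition Shift :: "tm \<Rightarrow> tm \<Rightarrow> tm \<Rightarrow> fm" where
  "Shift k a b = Tm_map (\<lambda>i d. Eq d (Var_code (Plus i (L 4 k)))) a b"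

text \<open>All substitutions needed are of the following form, with \<open>k = 0\<close> initially and
  \<open>k\<close> increasing under quantifiers.\<close>

definition sub :: "tm \<Rightarrow> nat \<Rightarrow> nat \<Rightarrow> nat \<Rightarrow> tm" where
  "sub u m k i = (if i < k then Var i else if i = k then L k u else Var (i - 1 + m))"

definition Subst_tm :: "tm \<Rightarrow> nat \<Rightarrow> tm \<Rightarrow> tm \<Rightarrow> tm \<Rightarrow> fm" where
  "Subst_tm u m k a b = Tm_map (\<lambda>i d.
     Disj (Conj (Lt i (L 4 k)) (Eq d (Var_code i)))
    (Disj (Conj (Eq i (L 4 k)) (Shift (L 4 k) (L 4 u) d))
          (Conj (Lt (L 4 k) i) (Eq (Plus d (nm 8)) (Var_code (Plus i (nm m))))))) a b"

text \<open>The formula \<open>b\<close> results from \<open>a\<close> by the substitution \<open>sub u m 0\<close>. In the clauses, the set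
  is \<open>Var 3\<close> and its element consists of the depth \<open>Var 2\<close> and the formulas \<open>Var 1\<close> and \<open>Var 0\<close>.\<close>

definition Subst :: "tm \<Rightarrow> nat \<Rightarrow> tm \<Rightarrow> tm \<Rightarrow> fm" where
  "Subst u m a b = BEx (Exp2 (Succ (Tup a (Tup a b))))
     (Conj (Mem (Tup Zero (Tup (L 1 a) (L 1 b))) (Var 0))
       (BAll (L 1 a) (BAll (L 2 a) (BAll (L 3 b)
         (Imp (Mem (Tup (Var 2) (Tup (Var 1) (Var 0))) (Var 3))
           (Disj (Conj (Eq (Var 1) Zero) (Eq (Var 0) Zero))
           (Disj
             (BEx (Var 1) (BEx (Var 2) (BEx (Var 2) (BEx (Var 3)
               (Disj
                 (Conj
                   (Disj
                     (Conj (Eq (Var 5) (Eq_code (Var 3) (Var 2))) (Eq (Var 4) (Eq_code (Var 1) (Var 0))))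
                     (Conj (Eq (Var 5) (Le_code (Var 3) (Var 2))) (Eq (Var 4) (Le_code (Var 1) (Var 0)))))
                   (Conj (Subst_tm (L 8 u) m (Var 6) (Var 3) (Var 1))
                         (Subst_tm (L 8 u) m (Var 6) (Var 2) (Var 0))))
                 (Conj
                   (Conj (Eq (Var 5) (Imp_code (Var 3) (Var 2))) (Eq (Var 4) (Imp_code (Var 1) (Var 0))))
                   (Conj (Mem (Tup (Var 6) (Tup (Var 3) (Var 1))) (Var 7))
                         (Mem (Tup (Var 6) (Tup (Var 2) (Var 0))) (Var 7)))))))))
             (BEx (Var 1) (BEx (Var 1)
               (Conj (Conj (Eq (Var 3) (All_code (Var 1))) (Eq (Var 2) (All_code (Var 0))))
                 (Mem (Tup (Succ (Var 4)) (Tup (Var 1) (Var 0))) (Var 5))))))))))))"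

text \<open>A formula is a sentence iff it does not change when \<open>0\<close> is substituted for \<open>Var 0\<close> and the
  other variables are lowered by one.\<close>

definition Sent :: "tm \<Rightarrow> fm" where
  "Sent a = Subst Zero 0 a a"

subsection \<open>Proofs\<close>

definition Logical_axiom :: "tm \<Rightarrow> fm" where
  "Logical_axiom x = BEx x (BEx (L 1 x) (BEx (L 2 x)
     (let x = L 3 x; a = Var 2; b = Var 1; c = Var 0 in
       Disj (Eq x (Imp_code a (Imp_code b a)))
      (Disj (Eq x (Imp_code (Imp_code a (Imp_code b c)) (Imp_code (Imp_code a b) (Imp_code a c))))
      (Disj (Eq x (Imp_code (Imp_code (Imp_code a \<ulcorner>Fls\<urcorner>) \<ulcorner>Fls\<urcorner>) a))
      (Disj (Conj (Eq x (Imp_code (All_code a) b)) (Subst c 0 a b))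
      (Disj (Eq x (Imp_code (All_code (Imp_code a b)) (Imp_code (All_code a) (All_code b))))
      (Disj (Conj (Eq x (Imp_code a (All_code b))) (Subst \<ulcorner>Var 1\<urcorner>\<^sub>t 2 a b))
      (Disj (Eq x (Eq_code a a))
            (Conj (Eq x (Imp_code \<ulcorner>Eq (Var 0) (Var 1)\<urcorner> (Imp_code a b)))
                  (Subst \<ulcorner>Var 1\<urcorner>\<^sub>t 1 a b)))))))))))"

text \<open>\<open>b\<close> is an element of the list \<open>q\<close>. In the matrix, \<open>Var 3\<close> is a set of final segments of \<open>q\<close>,
  and \<open>Var 2\<close> is an element of it with head \<open>Var 1\<close> and tail \<open>Var 0\<close>.\<close>

definition List_mem :: "tm \<Rightarrow> tm \<Rightarrow> fm" where
  "List_mem b q = BEx (Exp2 (Succ q)) (Conj (Mem (L 1 q) (Var 0))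
     (BAll (L 1 q) (Imp (Mem (Var 0) (Var 1))
       (BEx (Var 0) (BEx (Var 1) (Conj (Is_Cons (Var 2) (Var 1) (Var 0))
         (Disj (Eq (Var 1) (L 4 b)) (Mem (Var 0) (Var 3)))))))))"

text \<open>\<open>x\<close> may be put in front of the derivation \<open>q\<close>; \<open>F\<close> says that \<open>x\<close> is an assumption.\<close>

definition Justified :: "fm \<Rightarrow> tm \<Rightarrow> tm \<Rightarrow> fm" where
  "Justified F x q =
     Disj (Logical_axiom x)
    (Disj F
    (Disj (BEx q (Conj (List_mem (Var 0) (L 1 q)) (List_mem (Imp_code (Var 0) (L 1 x)) (L 1 q))))
          (BEx q (Conj (List_mem (Var 0) (L 1 q)) (Eq (L 1 x) (All_code (Var 0)))))))"

text \<open>\<open>p\<close> is a derivation from the formulas \<open>x\<close> with \<open>X x\<close>, which is used under 4 quantifiers.\<close>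

definition Derivation :: "(tm \<Rightarrow> fm) \<Rightarrow> tm \<Rightarrow> fm" where
  "Derivation X p = BEx (Exp2 (Succ p)) (Conj (Mem (L 1 p) (Var 0))
     (BAll (L 1 p) (Imp (Mem (Var 0) (Var 1))
       (Disj (Eq (Var 0) Zero)
         (BEx (Var 0) (BEx (Var 1)
           (Conj (Conj (Is_Cons (Var 2) (Var 1) (Var 0)) (Mem (Var 0) (Var 3)))
             (Justified (X (Var 1)) (Var 1) (Var 0)))))))))"

definition Proof :: "(tm \<Rightarrow> fm) \<Rightarrow> tm \<Rightarrow> tm \<Rightarrow> fm" where
  "Proof X p y = Conj (BEx p (Is_Cons (L 1 p) (L 1 y) (Var 0))) (Derivation X p)"

text \<open>\<open>p\<close> is a proof of \<open>y\<close> all of whose assumptions satisfy \<open>\<alpha>\<close>; or satisfy \<open>\<alpha>\<close> or equal \<open>z\<close>.\<close>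

definition Prf :: "fm \<Rightarrow> tm \<Rightarrow> tm \<Rightarrow> fm" where
  "Prf \<alpha> p y = Proof (\<lambda>x. inst [x] \<alpha>) p y"

definition Prf_from :: "fm \<Rightarrow> tm \<Rightarrow> tm \<Rightarrow> tm \<Rightarrow> fm" where
  "Prf_from \<alpha> z p y = Proof (\<lambda>x. Disj (inst [x] \<alpha>) (Eq x (L 4 z))) p y"

definition Prov :: "fm \<Rightarrow> tm \<Rightarrow> fm" where
  "Prov \<alpha> y = Ex (Prf \<alpha> (Var 0) (L 1 y))"

text \<open>\<open>\<box>\<^sub>(\<^sub>x\<^sub>) y\<close> and \<open>\<box>\<^sub>z\<^sub>,\<^sub>(\<^sub>x\<^sub>) y\<close>.\<close>

definition Box :: "fm \<Rightarrow> tm \<Rightarrow> tm \<Rightarrow> fm" where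
  "Box \<alpha> x y = BEx x (Prf \<alpha> (Var 0) (L 1 y))"

definition Box_from :: "fm \<Rightarrow> tm \<Rightarrow> tm \<Rightarrow> tm \<Rightarrow> fm" where
  "Box_from \<alpha> z x y = BEx x (Prf_from \<alpha> (L 1 z) (Var 0) (L 1 y))"

subsection \<open>The axioms of PA\<close>

definition Induction :: "tm \<Rightarrow> fm" where
  "Induction x = BEx x (BEx (L 1 x) (BEx (L 2 x)
     (let x = L 3 x; a = Var 2; b = Var 1; c = Var 0 in
       Conj (Eq x (Imp_code b (Imp_code (All_code (Imp_code a c)) (All_code a))))
        (Conj (Subst Zero 0 a b) (Subst \<ulcorner>Succ (Var 0)\<urcorner>\<^sub>t 1 a c)))))"

text \<open>\<open>x\<close> consists of quantifiers followed by an induction formula.\<close>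

definition Induction_closure :: "tm \<Rightarrow> fm" where
  "Induction_closure x = BEx (Exp2 (Succ x)) (Conj (Mem (L 1 x) (Var 0))
     (BAll (L 1 x) (Imp (Mem (Var 0) (Var 1))
       (Disj (Induction (Var 0))
         (BEx (Var 0) (Conj (Eq (Var 1) (All_code (Var 0))) (Mem (Var 0) (Var 2))))))))"

definition PA_axiom :: fm where
  "PA_axiom = Disj (foldr (\<lambda>A. Disj (Eq (Var 0) \<ulcorner>A\<urcorner>)) basic_axioms Fls)
     (Conj (Sent (Var 0)) (Induction_closure (Var 0)))"

subsection \<open>Propositional consequence\<close>

definition valuation :: "(fm \<Rightarrow> bool) \<Rightarrow> bool" where
  "valuation v \<longleftrightarrow> \<not> v Fls \<and> (\<forall>A B. v (Imp A B) \<longleftrightarrow> (v A \<longrightarrow> v B))"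

text \<open>\<open>A \<preceq>\<^sub>n B\<close>, for the theory \<open>T\<close>.\<close>

definition follows :: "fm set \<Rightarrow> nat \<Rightarrow> fm \<Rightarrow> fm \<Rightarrow> bool" where
  "follows T n A B \<longleftrightarrow> sentence A \<and> sentence B \<and> gn A \<le> n \<and> gn B \<le> n \<and>
     (\<forall>v. valuation v \<and> v A \<and> (\<forall>C. sentence C \<and> (\<exists>p \<le> n. codes_proof T p C) \<longrightarrow> v C)
        \<longrightarrow> v B)"

text \<open>The set \<open>v\<close> is the set of formulas made true by a valuation, as far as codes up to \<open>x\<close> are
  concerned. The codes of \<open>A\<close> and \<open>B\<close> are below that of \<open>Imp A B\<close>.\<close>

definition Valuation :: "tm \<Rightarrow> tm \<Rightarrow> fm" where
  "Valuation v x = Conj (Neg (Mem \<ulcorner>Fls\<urcorner> v))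
     (BAll x (BAll (L 1 x)
       (Imp (Le (Imp_code (Var 1) (Var 0)) (L 2 x))
         (Iff (Mem (Imp_code (Var 1) (Var 0)) (L 2 v))
           (Imp (Mem (Var 1) (L 2 v)) (Mem (Var 0) (L 2 v)))))))"

text \<open>The arithmetization of \<open>a \<preceq>\<^sub>x b\<close>: both are sentences up to \<open>x\<close>, and every valuation \<open>v\<close> that
  makes \<open>a\<close> true and every sentence with a proof up to \<open>x\<close> makes \<open>b\<close> true. The bound on \<open>v\<close>
  covers all sets of numbers up to \<open>x\<close>.\<close>

definition Follows :: "fm \<Rightarrow> tm \<Rightarrow> tm \<Rightarrow> tm \<Rightarrow> fm" where
  "Follows \<alpha> x a b =
     Conj (Conj (Conj (Sent a) (Sent b)) (Conj (Le a x) (Le b x)))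
      (BAll (Exp2 (Succ x))
        (Imp
          (Conj (Valuation (Var 0) (L 1 x))
          (Conj (Mem (L 1 a) (Var 0))
            (BAll (L 1 x) (Imp (Conj (Sent (Var 0)) (Box \<alpha> (L 2 x) (Var 0)))
              (Mem (Var 0) (Var 1))))))
          (Mem (L 1 b) (Var 0))))"

text \<open>\<open>\<Black>\<^sub>z\<^sub>,\<^sub>(\<^sub>x\<^sub>) y\<close>; the intermediate sentence is \<open>Var 0\<close>.\<close>

definition Black_box :: "fm \<Rightarrow> tm \<Rightarrow> tm \<Rightarrow> tm \<Rightarrow> fm" where
  "Black_box \<alpha> z x y =
     BEx x (Conj (Follows \<alpha> (L 1 x) (L 1 z) (Var 0)) (Box_from \<alpha> (Var 0) (L 1 x) (L 1 y)))"

section \<open>Adequacy\<close>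

lemma val_subst_tm: "val e (subst_tm \<sigma> t) = val (\<lambda>i. val e (\<sigma> i)) t"
  by (induction t) auto

lemma val_lift_tm [simp]: "val (case_nat n e) (lift_tm t) = val e t"
  by (simp add: lift_tm_def val_subst_tm)

lemma sat_subst: "sat e (subst \<sigma> A) \<longleftrightarrow> sat (\<lambda>i. val e (\<sigma> i)) A"
proof (induction A arbitrary: e \<sigma>)
  case (All A)
  have "(\<lambda>i. val (case_nat n e) (case i of 0 \<Rightarrow> Var 0 | Suc j \<Rightarrow> lift_tm (\<sigma> j)))
      = case_nat n (\<lambda>i. val e (\<sigma> i))" for n
    by (auto simp: fun_eq_iff split: nat.split)
  then show ?case
    by (simp add: All)
qed (auto simp: val_subst_tm)

lemma val_cong: "(\<And>i. i \<in> fv_tm t \<Longrightarrow> e i = e' i) \<Longrightarrow> val e t = val e' t"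
  by (induction t) auto

lemma sat_cong: "(\<And>i. i \<in> fv A \<Longrightarrow> e i = e' i) \<Longrightarrow> sat e A \<longleftrightarrow> sat e' A"
proof (induction A arbitrary: e e')
  case (Eq s t)
  then show ?case by (metis UnCI fv.simps(1) sat.simps(1) val_cong)
next
  case (Le s t)
  then show ?case by (metis UnCI fv.simps(2) sat.simps(2) val_cong)
next
  case (Imp A B)
  then show ?case by (metis UnCI fv.simps(4) sat.simps(4))
next
  case (All A)
  have "sat (case_nat n e) A \<longleftrightarrow> sat (case_nat n e') A" for n
    by (rule All.IH) (auto split: nat.split intro: All.prems)
  then show ?case by simp
qed simp

lemma val_nm [simp]: "val e (nm n) = n"
  by (induction n) auto

lemma sat_inst:
  "fv A \<subseteq> {..<length ts} \<Longrightarrow>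
     sat e (inst ts A) \<longleftrightarrow> sat (\<lambda>i. if i < length ts then val e (ts ! i) else 0) A"
  unfolding inst_def sat_subst by (rule sat_cong) auto

lemma sat_connectives [simp]:
  "sat e (Neg A) \<longleftrightarrow> \<not> sat e A"
  "sat e (Conj A B) \<longleftrightarrow> sat e A \<and> sat e B"
  "sat e (Disj A B) \<longleftrightarrow> sat e A \<or> sat e B"
  "sat e (Iff A B) \<longleftrightarrow> (sat e A \<longleftrightarrow> sat e B)"
  "sat e (Ex A) \<longleftrightarrow> (\<exists>n. sat (case_nat n e) A)"
  "sat e (BAll t A) \<longleftrightarrow> (\<forall>n \<le> val e t. sat (case_nat n e) A)"
  "sat e (BEx t A) \<longleftrightarrow> (\<exists>n \<le> val e t. sat (case_nat n e) A)"
  by (auto simp: Neg_def Conj_def Disj_def Iff_def Ex_def BAll_def BEx_def)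

lemma case_nat_1 [simp]: "case_nat a f (1 :: nat) = f 0"
  by (simp add: One_nat_def)

lemma val_L [simp]:
  "val (case_nat n e) (L 1 t) = val e t"
  "val (case_nat n e) (L (Suc k) t) = val e (L k t)"
  "val (case_nat n e) (L (numeral m) t) = val e (L (pred_numeral m) t)"
  by (simp_all add: numeral_eq_Suc)

lemma val_Tup [simp]: "val e (Tup s t) = 2 * prod_encode (val e s, val e t)"
proof -
  have *: "2 * triangle n = n * Suc n" for n
    by (induction n) auto
  show ?thesis
    unfolding prod_encode_def Tup_def using *[of "val e s + val e t"] by simp
qed

lemma val_Code [simp]:
  "val e (Code2 j s t) = 4 * prod_encode (val e s, val e t) + j"
  "val e (Code1 n j s) = n * val e s + j"
  by (simp_all add: Code2_def Code1_def)

lemma sat_Is_Cons [simp]: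
  "sat e (Is_Cons u s t) \<longleftrightarrow> val e u = Suc (prod_encode (val e s, val e t))"
  unfolding Is_Cons_def by (simp, presburger)

lemma sat_Mem [simp]: "sat e (Mem s t) \<longleftrightarrow> val e s \<in> set_decode (val e t)"
proof -
  let ?a = "val e s" and ?v = "val e t"
  have "(\<exists>q \<le> ?v. \<exists>r \<le> ?v. r < 2 ^ ?a \<and> ?v = Suc (q + q) * 2 ^ ?a + r) \<longleftrightarrow> odd (?v div 2 ^ ?a)"
  proof
    assume "\<exists>q \<le> ?v. \<exists>r \<le> ?v. r < 2 ^ ?a \<and> ?v = Suc (q + q) * 2 ^ ?a + r"
    then obtain q r where "r < 2 ^ ?a" "?v = Suc (q + q) * 2 ^ ?a + r" by blast
    then have "?v div 2 ^ ?a = Suc (q + q)"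
      by (metis add.commute add_0 div_less div_mult_self1 less_zeroE)
    then show "odd (?v div 2 ^ ?a)" by simp
  next
    assume "odd (?v div 2 ^ ?a)"
    then obtain q where q: "?v div 2 ^ ?a = Suc (q + q)"
      by (metis oddE Suc_eq_plus1 mult_2)
    have "?v = Suc (q + q) * 2 ^ ?a + ?v mod 2 ^ ?a"
      by (metis q div_mult_mod_eq)
    moreover have "q \<le> ?v"
      by (metis q div_le_dividend le_SucI le_add1 order_trans)
    ultimately show "\<exists>q \<le> ?v. \<exists>r \<le> ?v. r < 2 ^ ?a \<and> ?v = Suc (q + q) * 2 ^ ?a + r"
      by (metis mod_less_eq_dividend mod_less_divisor zero_less_numeral zero_less_power)
  qed
  then show ?thesis
    by (simp add: Mem_def set_decode_def Suc_le_eq)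
qed

lemma set_encode_bound:
  assumes "X \<subseteq> {..N}"
  shows "set_encode X \<le> 2 ^ Suc N" "set_decode (set_encode X) = X"
proof -
  have "set_encode X \<le> (\<Sum>i\<le>N. 2 ^ i)"
    unfolding set_encode_def using assms by (intro sum_mono2) auto
  also have "\<dots> \<le> 2 ^ Suc N"
    by (induction N) auto
  finally show "set_encode X \<le> 2 ^ Suc N" .
  show "set_decode (set_encode X) = X"
    using assms finite_subset by (auto intro!: set_encode_inverse)
qed

lemma ex_certificate:
  assumes "X \<subseteq> {..N}" "P X"
  shows "\<exists>s \<le> 2 ^ Suc N. P (set_decode s)"
  using assms set_encode_bound by metis

lemma prod_encode_mono:
  assumes "a \<le> a'" "b \<le> b'"
  shows "prod_encode (a, b) \<le> prod_encode (a', b')"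
proof -
  have "triangle m \<le> triangle n" if "m \<le> n" for m n
    using that by (induction n) (auto simp: le_Suc_eq)
  then show ?thesis
    using assms unfolding prod_encode_def by (simp add: add_mono)
qed

lemma gn_tm_inject [simp]: "gn_tm s = gn_tm t \<longleftrightarrow> s = t"
proof
  show "gn_tm s = gn_tm t \<Longrightarrow> s = t"
  proof (induction s arbitrary: t)
    case (Var i) then show ?case by (cases t) (simp_all, presburger+)
  next
    case Zero then show ?case by (cases t) simp_all
  next
    case (Succ s) then show ?case by (cases t) (simp_all, presburger+)
  next
    case (Plus s1 s2) then show ?case by (cases t) (simp_all, presburger+)
  next
    case (Times s1 s2) then show ?case by (cases t) (simp_all, presburger+)
  next
    case (Exp2 s) then show ?case by (cases t) (simp_all, presburger+)
  qed
qed simp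

lemma gn_inject [simp]: "gn A = gn B \<longleftrightarrow> A = B"
proof
  show "gn A = gn B \<Longrightarrow> A = B"
  proof (induction A arbitrary: B)
    case (Eq s t) then show ?case by (cases B) (simp_all, presburger+)
  next
    case (Le s t) then show ?case by (cases B) (simp_all, presburger+)
  next
    case Fls then show ?case by (cases B) simp_all
  next
    case (Imp A1 A2) then show ?case by (cases B) (simp_all, presburger+)
  next
    case (All A) then show ?case by (cases B) (simp_all, presburger+)
  qed
qed simp

lemma surj_gn_tm: "\<exists>t. gn_tm t = n"
proof (induction n rule: less_induct)
  case (less n)
  show ?case
  proof (cases n)
    case 0
    then show ?thesis by (metis gn_tm.simps(1))
  next
    case (Suc m)
    obtain a b where ab: "m div 4 = prod_encode (a, b)"
      by (metis prod_decode_inverse surj_pair)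
    have "a \<le> m div 4" "b \<le> m div 4"
      using ab by (simp_all add: le_prod_encode_1 le_prod_encode_2)
    then have "a < n" "b < n" "m div 4 < n" "m div 8 < n"
      using Suc by auto
    then obtain s t u v where stu: "gn_tm s = a" "gn_tm t = b" "gn_tm u = m div 4" "gn_tm v = m div 8"
      using less by meson
    have m: "n = 4 * (m div 4) + m mod 4 + 1" using Suc by simp
    have m8: "n = 8 * (m div 8) + m mod 8 + 1" using Suc by simp
    have "m mod 8 = 0 \<or> m mod 8 = 4 \<or> m mod 4 = 1 \<or> m mod 4 = 2 \<or> m mod 4 = 3"
      by presburger
    then consider "m mod 8 = 0" | "m mod 8 = 4" | "m mod 4 = 1" | "m mod 4 = 2" | "m mod 4 = 3"
      by auto
    then show ?thesis
    proof cases
      case 1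
      then have "gn_tm (Var (m div 8)) = n" using m8 by simp
      then show ?thesis ..
    next
      case 2
      then have "gn_tm (Exp2 v) = n" using m8 stu by simp
      then show ?thesis ..
    next
      case 3
      then have "gn_tm (Succ u) = n" using m stu by simp
      then show ?thesis ..
    next
      case 4
      then have "gn_tm (Plus s t) = n" using m stu ab by simp
      then show ?thesis ..
    next
      case 5
      then have "gn_tm (Times s t) = n" using m stu ab by simp
      then show ?thesis ..
    qed
  qed
qed

lemma surj_gn: "\<exists>A. gn A = n"
proof (induction n rule: less_induct)
  case (less n)
  show ?case
  proof (cases n)
    case 0
    then show ?thesis by (metis gn.simps(1))
  next
    case (Suc m)
    obtain a b where ab: "m div 4 = prod_encode (a, b)"
      by (metis prod_decode_inverse surj_pair)
    have "a \<le> m div 4" "b \<le> m div 4"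
      using ab by (simp_all add: le_prod_encode_1 le_prod_encode_2)
    then have "a < n" "b < n" "m div 4 < n"
      using Suc by auto
    then obtain A B C where ABC: "gn A = a" "gn B = b" "gn C = m div 4"
      using less by meson
    obtain s t where st: "gn_tm s = a" "gn_tm t = b"
      using surj_gn_tm by meson
    have m: "n = 4 * (m div 4) + m mod 4 + 1" using Suc by simp
    have "m mod 4 < 4" by simp
    then consider "m mod 4 = 0" | "m mod 4 = 1" | "m mod 4 = 2" | "m mod 4 = 3"
      by linarith
    then show ?thesis
    proof cases
      case 1
      then have "gn (Eq s t) = n" using m st ab by simp
      then show ?thesis ..
    next
      case 2
      then have "gn (Le s t) = n" using m st ab by simp
      then show ?thesis ..
    next
      case 3
      then have "gn (Imp A B) = n" using m ABC ab by simp
      then show ?thesis ..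
    next
      case 4
      then have "gn (All C) = n" using m ABC by simp
      then show ?thesis ..
    qed
  qed
qed

lemma le_prod_encode: "a \<le> prod_encode (a, b) \<and> b \<le> prod_encode (a, b)"
  by (simp_all add: le_prod_encode_1 le_prod_encode_2)

text \<open>Codes of terms and formulas of different kinds are different.\<close>

lemma code_distinct [simp]:
  fixes x y :: nat
  shows "4 * x \<noteq> Suc (4 * y)" "4 * x \<noteq> Suc (Suc (4 * y))" "4 * x \<noteq> 4 * y + 3"
    "Suc (4 * y) \<noteq> 4 * x" "Suc (Suc (4 * y)) \<noteq> 4 * x" "4 * y + 3 \<noteq> 4 * x"
    "Suc (4 * y) \<noteq> 4 * x + 4" "Suc (Suc (4 * y)) \<noteq> 4 * x + 4" "4 * y + 3 \<noteq> 4 * x + 4"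
    "4 * x + 4 \<noteq> Suc (4 * y)" "4 * x + 4 \<noteq> Suc (Suc (4 * y))" "4 * x + 4 \<noteq> 4 * y + 3"
    "Suc (4 * y) \<noteq> 4 * x + 3" "Suc (Suc (4 * y)) \<noteq> 4 * x + 3"
    "4 * x + 3 \<noteq> Suc (4 * y)" "4 * x + 3 \<noteq> Suc (Suc (4 * y))"
    "8 * x \<noteq> Suc (4 * y)" "8 * x \<noteq> Suc (Suc (4 * y))" "8 * x \<noteq> 4 * y + 3"
    "Suc (4 * y) \<noteq> 8 * x" "Suc (Suc (4 * y)) \<noteq> 8 * x" "4 * y + 3 \<noteq> 8 * x"
    "8 * x + 4 \<noteq> 8 * y" "8 * x \<noteq> 8 * y + 4"
    "Suc (8 * x) \<noteq> 4 * y + 3" "Suc (8 * x) \<noteq> 4 * y + 4" "Suc (8 * x) \<noteq> 8 * y + 5"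
    "4 * y + 3 \<noteq> Suc (8 * x)" "4 * y + 4 \<noteq> Suc (8 * x)" "8 * y + 5 \<noteq> Suc (8 * x)"
    "8 * x + 5 \<noteq> Suc (Suc (4 * y))" "8 * x + 5 \<noteq> 4 * y + 3" "8 * x + 5 \<noteq> 4 * y + 4"
    "Suc (Suc (4 * y)) \<noteq> 8 * x + 5" "4 * y + 3 \<noteq> 8 * x + 5" "4 * y + 4 \<noteq> 8 * x + 5"
  by presburger+

definition tm_clause :: "(nat \<Rightarrow> tm) \<Rightarrow> nat set \<Rightarrow> nat \<Rightarrow> nat \<Rightarrow> bool" where
  "tm_clause \<sigma> S c d \<longleftrightarrow>
     c = 0 \<and> d = 0 \<or>
     (\<exists>i \<le> c. c = 8 * i + 1 \<and> d = gn_tm (\<sigma> i)) \<or>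
     (\<exists>c' \<le> c. \<exists>d' \<le> d. 2 * prod_encode (c', d') \<in> S \<and>
        (c = 4 * c' + 2 \<and> d = 4 * d' + 2 \<or> c = 8 * c' + 5 \<and> d = 8 * d' + 5)) \<or>
     (\<exists>c1 \<le> c. \<exists>c2 \<le> c. \<exists>d1 \<le> d. \<exists>d2 \<le> d.
        (2 * prod_encode (c1, d1) \<in> S \<and> 2 * prod_encode (c2, d2) \<in> S) \<and>
        (c = 4 * prod_encode (c1, c2) + 3 \<and> d = 4 * prod_encode (d1, d2) + 3 \<or>
         c = 4 * prod_encode (c1, c2) + 4 \<and> d = 4 * prod_encode (d1, d2) + 4))"

lemma tm_certificate_sound:
  assumes clause: "\<And>c d. c \<le> a \<Longrightarrow> d \<le> b \<Longrightarrow> 2 * prod_encode (c, d) \<in> S \<Longrightarrow> tm_clause \<sigma> S c d"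
  shows "2 * prod_encode (gn_tm t, d) \<in> S \<Longrightarrow> gn_tm t \<le> a \<Longrightarrow> d \<le> b \<Longrightarrow> d = gn_tm (subst_tm \<sigma> t)"
proof (induction t arbitrary: d)
  case (Var i)
  from clause[OF Var(2,3,1)] show ?case
    by (auto simp: tm_clause_def)
next
  case Zero
  from clause[OF Zero(2,3,1)] show ?case
    by (auto simp: tm_clause_def)
next
  case (Succ t)
  from clause[OF Succ(3,4,2)] obtain d' where
    "2 * prod_encode (gn_tm t, d') \<in> S" "d = 4 * d' + 2"
    by (auto simp: tm_clause_def)
  with Succ show ?case by simp
next
  case (Exp2 t)
  from clause[OF Exp2(3,4,2)] obtain d' where
    "2 * prod_encode (gn_tm t, d') \<in> S" "d = 8 * d' + 5"
    by (auto simp: tm_clause_def)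
  with Exp2 show ?case by simp
next
  case (Plus s t)
  from clause[OF Plus(4,5,3)] obtain c1 c2 d1 d2 where
    *: "2 * prod_encode (c1, d1) \<in> S" "2 * prod_encode (c2, d2) \<in> S"
    "d = 4 * prod_encode (d1, d2) + 3" "prod_encode (gn_tm s, gn_tm t) = prod_encode (c1, c2)"
    by (auto simp: tm_clause_def)
  have "c1 = gn_tm s" "c2 = gn_tm t"
    using *(4) by simp_all
  moreover have "gn_tm s \<le> a" "gn_tm t \<le> a" "d1 \<le> b" "d2 \<le> b"
    using Plus(4,5) *(3) le_prod_encode[of "gn_tm s" "gn_tm t"] le_prod_encode[of d1 d2]
    by simp_all
  ultimately show ?case
    using Plus(1,2) * by simp
next
  case (Times s t)
  from clause[OF Times(4,5,3)] obtain c1 c2 d1 d2 where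
    *: "2 * prod_encode (c1, d1) \<in> S" "2 * prod_encode (c2, d2) \<in> S"
    "d = 4 * prod_encode (d1, d2) + 4" "prod_encode (gn_tm s, gn_tm t) = prod_encode (c1, c2)"
    by (auto simp: tm_clause_def)
  have "c1 = gn_tm s" "c2 = gn_tm t"
    using *(4) by simp_all
  moreover have "gn_tm s \<le> a" "gn_tm t \<le> a" "d1 \<le> b" "d2 \<le> b"
    using Times(4,5) *(3) le_prod_encode[of "gn_tm s" "gn_tm t"] le_prod_encode[of d1 d2]
    by simp_all
  ultimately show ?case
    using Times(1,2) * by simp
qed

lemma tm_certificate_complete:
  assumes S: "S = {2 * prod_encode (gn_tm t, gn_tm (subst_tm \<sigma> t)) | t. gn_tm t \<le> a \<and> gn_tm (subst_tm \<sigma> t) \<le> b}"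
    and "2 * prod_encode (c, d) \<in> S"
  shows "tm_clause \<sigma> S c d"
proof -
  from assms obtain t where t: "c = gn_tm t" "d = gn_tm (subst_tm \<sigma> t)" "c \<le> a" "d \<le> b"
    by auto
  have S': "2 * prod_encode (gn_tm s, gn_tm (subst_tm \<sigma> s)) \<in> S"
    if "gn_tm s \<le> c" "gn_tm (subst_tm \<sigma> s) \<le> d" for s
    using that t(3,4) unfolding S by auto
  show ?thesis
  proof (cases t)
    case (Plus s1 s2)
    have *: "gn_tm s1 \<le> c" "gn_tm s2 \<le> c" "gn_tm (subst_tm \<sigma> s1) \<le> d" "gn_tm (subst_tm \<sigma> s2) \<le> d"
      using t Plus le_prod_encode[of "gn_tm s1" "gn_tm s2"]
        le_prod_encode[of "gn_tm (subst_tm \<sigma> s1)" "gn_tm (subst_tm \<sigma> s2)"] by simp_all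
    then have "c = 4 * prod_encode (gn_tm s1, gn_tm s2) + 3 \<and>
        d = 4 * prod_encode (gn_tm (subst_tm \<sigma> s1), gn_tm (subst_tm \<sigma> s2)) + 3"
      using t Plus by simp
    then show ?thesis
      unfolding tm_clause_def using * S' by blast
  next
    case (Times s1 s2)
    have *: "gn_tm s1 \<le> c" "gn_tm s2 \<le> c" "gn_tm (subst_tm \<sigma> s1) \<le> d" "gn_tm (subst_tm \<sigma> s2) \<le> d"
      using t Times le_prod_encode[of "gn_tm s1" "gn_tm s2"]
        le_prod_encode[of "gn_tm (subst_tm \<sigma> s1)" "gn_tm (subst_tm \<sigma> s2)"] by simp_all
    then have "c = 4 * prod_encode (gn_tm s1, gn_tm s2) + 4 \<and>
        d = 4 * prod_encode (gn_tm (subst_tm \<sigma> s1), gn_tm (subst_tm \<sigma> s2)) + 4"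
      using t Times by simp
    then show ?thesis
      unfolding tm_clause_def using * S' by blast
  next
    case (Var i)
    then have "i \<le> c \<and> c = 8 * i + 1 \<and> d = gn_tm (\<sigma> i)"
      using t by simp
    then show ?thesis
      unfolding tm_clause_def by blast
  next
    case Zero
    then show ?thesis
      using t unfolding tm_clause_def by simp
  next
    case (Succ s)
    then have "gn_tm s \<le> c" "gn_tm (subst_tm \<sigma> s) \<le> d"
      "c = 4 * gn_tm s + 2 \<and> d = 4 * gn_tm (subst_tm \<sigma> s) + 2"
      using t by simp_all
    then show ?thesis
      unfolding tm_clause_def using S' by blast
  next
    case (Exp2 s)
    then have "gn_tm s \<le> c" "gn_tm (subst_tm \<sigma> s) \<le> d"
      "c = 8 * gn_tm s + 5 \<and> d = 8 * gn_tm (subst_tm \<sigma> s) + 5"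
      using t by simp_all
    then show ?thesis
      unfolding tm_clause_def using S' by blast
  qed
qed

lemma sat_Tm_map:
  assumes V: "\<And>i d c s. sat (case_nat i (case_nat d (case_nat c (case_nat s e)))) (V (Var 0) (Var 1))
      \<longleftrightarrow> d = gn_tm (\<sigma> i)"
    and a: "val e a = gn_tm t"
  shows "sat e (Tm_map V a b) \<longleftrightarrow> val e b = gn_tm (subst_tm \<sigma> t)"
proof -
  let ?a = "val e a" and ?b = "val e b"
  let ?P = "\<lambda>S. 2 * prod_encode (?a, ?b) \<in> S \<and>
     (\<forall>c \<le> ?a. \<forall>d \<le> ?b. 2 * prod_encode (c, d) \<in> S \<longrightarrow> tm_clause \<sigma> S c d)"
  have "sat e (Tm_map V a b) \<longleftrightarrow> (\<exists>s \<le> 2 ^ Suc (2 * prod_encode (?a, ?b)). ?P (set_decode s))"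
    by (simp add: Tm_map_def V[unfolded One_nat_def] tm_clause_def)
  also have "\<dots> \<longleftrightarrow> ?b = gn_tm (subst_tm \<sigma> t)"
  proof
    assume "\<exists>s \<le> 2 ^ Suc (2 * prod_encode (?a, ?b)). ?P (set_decode s)"
    then show "?b = gn_tm (subst_tm \<sigma> t)"
      using tm_certificate_sound[of ?a ?b _ \<sigma> t ?b] a by auto
  next
    assume b: "?b = gn_tm (subst_tm \<sigma> t)"
    define S where "S = {2 * prod_encode (gn_tm t, gn_tm (subst_tm \<sigma> t)) | t.
      gn_tm t \<le> ?a \<and> gn_tm (subst_tm \<sigma> t) \<le> ?b}"
    show "\<exists>s \<le> 2 ^ Suc (2 * prod_encode (?a, ?b)). ?P (set_decode s)"
    proof (rule ex_certificate)
      show "S \<subseteq> {..2 * prod_encode (?a, ?b)}"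
        unfolding S_def by (auto intro: prod_encode_mono)
      show "?P S"
        using tm_certificate_complete[OF S_def] a b by (auto simp: S_def)
    qed
  qed
  finally show ?thesis .
qed

lemma subst_tm_subst_tm: "subst_tm \<sigma> (subst_tm \<tau> t) = subst_tm (\<lambda>i. subst_tm \<sigma> (\<tau> i)) t"
  by (induction t) auto

lemma subst_tm_Var [simp]: "subst_tm Var t = t"
  by (induction t) auto

lemma L_eq_subst_tm: "L k t = subst_tm (\<lambda>i. Var (i + k)) t"
  by (induction k) (simp_all add: lift_tm_def subst_tm_subst_tm)

lemma sat_Shift:
  assumes "val e a = gn_tm t"
  shows "sat e (Shift k a b) \<longleftrightarrow> val e b = gn_tm (L (val e k) t)"
proof -
  have "sat e (Shift k a b) \<longleftrightarrow> val e b = gn_tm (subst_tm (\<lambda>i. Var (i + val e k)) t)"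
    unfolding Shift_def by (rule sat_Tm_map) (simp_all add: assms)
  then show ?thesis
    by (simp only: L_eq_subst_tm)
qed

lemma sat_Subst_tm:
  assumes u: "val e u = gn_tm u0"
  shows "sat e (Subst_tm u m k a b) \<longleftrightarrow>
    (\<exists>t. val e a = gn_tm t \<and> val e b = gn_tm (subst_tm (sub u0 m (val e k)) t))"
proof -
  obtain t where t: "val e a = gn_tm t"
    using surj_gn_tm by metis
  have "sat e (Subst_tm u m k a b) \<longleftrightarrow> val e b = gn_tm (subst_tm (sub u0 m (val e k)) t)"
    unfolding Subst_tm_def
    by (rule sat_Tm_map) (auto simp: t u sub_def sat_Shift[where t = u0])
  with t show ?thesis by simp
qed

lemma sub_Suc: "case_nat (Var 0) (\<lambda>i. lift_tm (sub u m k i)) = sub u m (Suc k)"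
proof
  fix i
  show "case_nat (Var 0) (\<lambda>i. lift_tm (sub u m k i)) i = sub u m (Suc k) i"
    by (cases i) (simp_all add: sub_def lift_tm_def)
qed

definition fm_clause :: "tm \<Rightarrow> nat \<Rightarrow> nat set \<Rightarrow> nat \<Rightarrow> nat \<Rightarrow> nat \<Rightarrow> bool" where
  "fm_clause u m S k c d \<longleftrightarrow>
     c = 0 \<and> d = 0 \<or>
     (\<exists>c1 \<le> c. \<exists>c2 \<le> c. \<exists>d1 \<le> d. \<exists>d2 \<le> d.
        (c = 4 * prod_encode (c1, c2) + 1 \<and> d = 4 * prod_encode (d1, d2) + 1 \<or>
         c = 4 * prod_encode (c1, c2) + 2 \<and> d = 4 * prod_encode (d1, d2) + 2) \<and>
        (\<exists>t. c1 = gn_tm t \<and> d1 = gn_tm (subst_tm (sub u m k) t)) \<and>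
        (\<exists>t. c2 = gn_tm t \<and> d2 = gn_tm (subst_tm (sub u m k) t)) \<or>
        (c = 4 * prod_encode (c1, c2) + 3 \<and> d = 4 * prod_encode (d1, d2) + 3) \<and>
        2 * prod_encode (k, 2 * prod_encode (c1, d1)) \<in> S \<and>
        2 * prod_encode (k, 2 * prod_encode (c2, d2)) \<in> S) \<or>
     (\<exists>c' \<le> c. \<exists>d' \<le> d. (c = 4 * c' + 4 \<and> d = 4 * d' + 4) \<and>
        2 * prod_encode (Suc k, 2 * prod_encode (c', d')) \<in> S)"

lemma fm_certificate_sound:
  assumes clause: "\<And>k c d. k \<le> a \<Longrightarrow> c \<le> a \<Longrightarrow> d \<le> b \<Longrightarrow>
      2 * prod_encode (k, 2 * prod_encode (c, d)) \<in> S \<Longrightarrow> fm_clause u m S k c d"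
  shows "2 * prod_encode (k, 2 * prod_encode (gn A, d)) \<in> S \<Longrightarrow> k + gn A \<le> a \<Longrightarrow> d \<le> b \<Longrightarrow>
      d = gn (subst (sub u m k) A)"
proof (induction A arbitrary: k d)
  case (Eq s t)
  from Eq(2) have "k \<le> a" "gn (Eq s t) \<le> a" by simp_all
  from clause[OF this Eq(3,1)] show ?case
    by (auto simp: fm_clause_def)
next
  case (Le s t)
  from Le(2) have "k \<le> a" "gn (Le s t) \<le> a" by simp_all
  from clause[OF this Le(3,1)] show ?case
    by (auto simp: fm_clause_def)
next
  case Fls
  from Fls(2) have "k \<le> a" "gn Fls \<le> a" by simp_all
  from clause[OF this Fls(3,1)] show ?case
    by (auto simp: fm_clause_def)
next
  case (Imp A B)
  from Imp(4) have "k \<le> a" "gn (Imp A B) \<le> a" by simp_all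
  from clause[OF this Imp(5,3)] obtain d1 d2 where *:
    "2 * prod_encode (k, 2 * prod_encode (gn A, d1)) \<in> S"
    "2 * prod_encode (k, 2 * prod_encode (gn B, d2)) \<in> S"
    "d = 4 * prod_encode (d1, d2) + 3"
    by (auto simp: fm_clause_def)
  moreover have "k + gn A \<le> a" "k + gn B \<le> a" "d1 \<le> b" "d2 \<le> b"
    using Imp(4,5) *(3) le_prod_encode[of "gn A" "gn B"] le_prod_encode[of d1 d2] by simp_all
  ultimately show ?case
    using Imp(1,2) by simp
next
  case (All A)
  from All(3) have "k \<le> a" "gn (fm.All A) \<le> a" by simp_all
  from clause[OF this All(4,2)] obtain d' where *:
    "2 * prod_encode (Suc k, 2 * prod_encode (gn A, d')) \<in> S" "d = 4 * d' + 4"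
    by (auto simp: fm_clause_def)
  moreover have "Suc k + gn A \<le> a" "d' \<le> b"
    using All(3,4) * by simp_all
  ultimately show ?case
    using All(1)[of "Suc k" d'] by (simp add: sub_Suc)
qed

lemma fm_certificate_complete:
  assumes S: "S = {2 * prod_encode (k, 2 * prod_encode (gn A, gn (subst (sub u m k) A))) | k A.
      k + gn A \<le> a \<and> gn (subst (sub u m k) A) \<le> b}"
    and "2 * prod_encode (k, 2 * prod_encode (c, d)) \<in> S"
  shows "fm_clause u m S k c d"
proof -
  from assms obtain A where A: "c = gn A" "d = gn (subst (sub u m k) A)" "k + c \<le> a" "d \<le> b"
    by auto
  have S': "2 * prod_encode (j, 2 * prod_encode (gn B, gn (subst (sub u m j) B))) \<in> S"
    if "j + gn B \<le> k + c" "gn (subst (sub u m j) B) \<le> d" for B j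
    using that A(3,4) unfolding S by fastforce
  show ?thesis
  proof (cases A)
    case (Imp B C)
    have *: "gn B \<le> c" "gn C \<le> c" "gn (subst (sub u m k) B) \<le> d" "gn (subst (sub u m k) C) \<le> d"
      using A Imp le_prod_encode[of "gn B" "gn C"]
        le_prod_encode[of "gn (subst (sub u m k) B)" "gn (subst (sub u m k) C)"] by simp_all
    then have "c = 4 * prod_encode (gn B, gn C) + 3 \<and>
        d = 4 * prod_encode (gn (subst (sub u m k) B), gn (subst (sub u m k) C)) + 3"
      using A Imp by simp
    moreover have "2 * prod_encode (k, 2 * prod_encode (gn B, gn (subst (sub u m k) B))) \<in> S"
      "2 * prod_encode (k, 2 * prod_encode (gn C, gn (subst (sub u m k) C))) \<in> S"
      using * by (auto intro: S')
    ultimately show ?thesis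
      unfolding fm_clause_def using * by blast
  next
    case (All B)
    then have "gn B \<le> c" "gn (subst (sub u m (Suc k)) B) \<le> d"
      "c = 4 * gn B + 4 \<and> d = 4 * gn (subst (sub u m (Suc k)) B) + 4"
      using A by (simp_all add: sub_Suc)
    moreover from this
    have "2 * prod_encode (Suc k, 2 * prod_encode (gn B, gn (subst (sub u m (Suc k)) B))) \<in> S"
      by (intro S') auto
    ultimately show ?thesis
      unfolding fm_clause_def by blast
  next
    case (Eq s t)
    have *: "gn_tm s \<le> c" "gn_tm t \<le> c"
      "gn_tm (subst_tm (sub u m k) s) \<le> d" "gn_tm (subst_tm (sub u m k) t) \<le> d"
      using A Eq le_prod_encode[of "gn_tm s" "gn_tm t"]
        le_prod_encode[of "gn_tm (subst_tm (sub u m k) s)" "gn_tm (subst_tm (sub u m k) t)"]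
      by simp_all
    then have "c = 4 * prod_encode (gn_tm s, gn_tm t) + 1 \<and>
        d = 4 * prod_encode (gn_tm (subst_tm (sub u m k) s), gn_tm (subst_tm (sub u m k) t)) + 1"
      using A Eq by simp
    then show ?thesis
      unfolding fm_clause_def using * by blast
  next
    case (Le s t)
    have *: "gn_tm s \<le> c" "gn_tm t \<le> c"
      "gn_tm (subst_tm (sub u m k) s) \<le> d" "gn_tm (subst_tm (sub u m k) t) \<le> d"
      using A Le le_prod_encode[of "gn_tm s" "gn_tm t"]
        le_prod_encode[of "gn_tm (subst_tm (sub u m k) s)" "gn_tm (subst_tm (sub u m k) t)"]
      by simp_all
    then have "c = 4 * prod_encode (gn_tm s, gn_tm t) + 2 \<and>
        d = 4 * prod_encode (gn_tm (subst_tm (sub u m k) s), gn_tm (subst_tm (sub u m k) t)) + 2"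
      using A Le by simp
    then show ?thesis
      unfolding fm_clause_def using * by blast
  next
    case Fls
    then show ?thesis
      using A unfolding fm_clause_def by simp
  qed
qed

lemma sat_Subst:
  assumes u: "val e u = gn_tm u0" and a: "val e a = gn A"
  shows "sat e (Subst u m a b) \<longleftrightarrow> val e b = gn (subst (sub u0 m 0) A)"
proof -
  let ?a = "val e a" and ?b = "val e b"
  let ?N = "2 * prod_encode (?a, 2 * prod_encode (?a, ?b))"
  let ?P = "\<lambda>S. 2 * prod_encode (0, 2 * prod_encode (?a, ?b)) \<in> S \<and>
     (\<forall>k \<le> ?a. \<forall>c \<le> ?a. \<forall>d \<le> ?b. 2 * prod_encode (k, 2 * prod_encode (c, d)) \<in> S \<longrightarrow>
        fm_clause u0 m S k c d)"
  have "sat e (Subst u m a b) \<longleftrightarrow> (\<exists>s \<le> 2 ^ Suc ?N. ?P (set_decode s))"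
    by (simp add: Subst_def sat_Subst_tm[where ?u0.0 = u0] u fm_clause_def)
  also have "\<dots> \<longleftrightarrow> ?b = gn (subst (sub u0 m 0) A)"
  proof
    assume "\<exists>s \<le> 2 ^ Suc ?N. ?P (set_decode s)"
    then show "?b = gn (subst (sub u0 m 0) A)"
      using fm_certificate_sound[of ?a ?b _ u0 m 0 A ?b] a by auto
  next
    assume b: "?b = gn (subst (sub u0 m 0) A)"
    define S where "S = {2 * prod_encode (k, 2 * prod_encode (gn A, gn (subst (sub u0 m k) A))) | k A.
      k + gn A \<le> ?a \<and> gn (subst (sub u0 m k) A) \<le> ?b}"
    show "\<exists>s \<le> 2 ^ Suc ?N. ?P (set_decode s)"
    proof (rule ex_certificate)
      show "S \<subseteq> {..?N}"
        unfolding S_def by (auto intro!: prod_encode_mono)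
      show "?P S"
        using fm_certificate_complete[OF S_def] a b by (auto simp: S_def)
    qed
  qed
  finally show ?thesis .
qed

lemma L_Zero [simp]: "L k Zero = Zero"
  by (simp add: L_eq_subst_tm)

lemma subst_tm_fixed: "subst_tm (sub Zero 0 k) t = t \<longleftrightarrow> fv_tm t \<subseteq> {..<k}"
  by (induction t) (auto simp: sub_def)

lemma subst_fixed: "subst (sub Zero 0 k) A = A \<longleftrightarrow> fv A \<subseteq> {..<k}"
proof (induction A arbitrary: k)
  case (All A)
  have "{i. Suc i \<in> fv A} \<subseteq> {..<k} \<longleftrightarrow> fv A \<subseteq> {..<Suc k}"
    by (auto simp: subset_iff less_Suc_eq_0_disj) (metis not0_implies_Suc)+
  then show ?case
    by (simp add: sub_Suc All)
qed (simp_all add: subst_tm_fixed)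

lemma sat_Sent:
  assumes "val e a = gn A"
  shows "sat e (Sent a) \<longleftrightarrow> sentence A"
  unfolding Sent_def sentence_def
  using sat_Subst[of e Zero Zero a A] subst_fixed[of 0 A] assms by auto

lemma subst_sub:
  "subst (sub t 0 0) = inst [t]"
  "subst (sub (Var 1) 2 0) = lift"
  "subst (sub (Var 1) 1 0) = rename_fm"
  "subst (sub (Succ (Var 0)) 1 0) = succ_fm"
  unfolding inst_def lift_def rename_fm_def succ_fm_def
  by (rule arg_cong[where f = subst], force simp: fun_eq_iff sub_def split: nat.split)+

lemma val_quote [simp]: "val e \<ulcorner>A\<urcorner> = gn A" "val e \<ulcorner>t\<urcorner>\<^sub>t = gn_tm t"
  by (simp_all add: quote_fm_def quote_tm_def)

lemma sat_Subst_inst: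
  assumes "val e a = gn A" "val e b = gn B"
  shows "sat e (Subst u 0 a b) \<longleftrightarrow> (\<exists>t. val e u = gn_tm t \<and> B = inst [t] A)"
proof -
  obtain t where "val e u = gn_tm t"
    using surj_gn_tm by metis
  then show ?thesis
    using sat_Subst[of e u t a A 0 b] assms by (auto simp: subst_sub)
qed

lemma sat_Subst_lift:
  assumes "val e a = gn A" "val e b = gn B"
  shows "sat e (Subst \<ulcorner>Var 1\<urcorner>\<^sub>t 2 a b) \<longleftrightarrow> B = lift A"
    "sat e (Subst \<ulcorner>Var 1\<urcorner>\<^sub>t 1 a b) \<longleftrightarrow> B = rename_fm A"
    "sat e (Subst \<ulcorner>Succ (Var 0)\<urcorner>\<^sub>t 1 a b) \<longleftrightarrow> B = succ_fm A"
  using sat_Subst[of e "\<ulcorner>Var 1\<urcorner>\<^sub>t" "Var 1" a A _ b]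
    sat_Subst[of e "\<ulcorner>Succ (Var 0)\<urcorner>\<^sub>t" "Succ (Var 0)" a A _ b] assms
  by (simp_all only: val_quote subst_sub gn_inject)

lemma sat_BEx_fm:
  "sat e (BEx t A) \<longleftrightarrow> (\<exists>B. gn B \<le> val e t \<and> sat (case_nat (gn B) e) A)"
  by simp (metis surj_gn)

lemma gn_fold:
  "4 * prod_encode (gn A, gn B) + 3 = gn (Imp A B)"
  "4 * gn A + 4 = gn (fm.All A)"
  by simp_all

text \<open>If the substituted variable does not occur, then any term will do; otherwise the code of
  the term is below that of the result.\<close>

lemma gn_tm_le_L: "gn_tm t \<le> gn_tm (L k t)"
  unfolding L_eq_subst_tm by (induction t) (auto intro: prod_encode_mono)

lemma gn_tm_le_subst_tm:
  "k \<in> fv_tm s \<Longrightarrow> gn_tm t \<le> gn_tm (subst_tm (sub t m k) s)"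
proof (induction s)
  case (Plus s1 s2)
  then show ?case
    using le_prod_encode[of "gn_tm (subst_tm (sub t m k) s1)" "gn_tm (subst_tm (sub t m k) s2)"]
    by fastforce
next
  case (Times s1 s2)
  then show ?case
    using le_prod_encode[of "gn_tm (subst_tm (sub t m k) s1)" "gn_tm (subst_tm (sub t m k) s2)"]
    by fastforce
qed (auto simp: sub_def gn_tm_le_L)

lemma gn_tm_le_subst:
  "k \<in> fv A \<Longrightarrow> gn_tm t \<le> gn (subst (sub t m k) A)"
proof (induction A arbitrary: k)
  case (Eq s1 s2)
  then show ?case
    using le_prod_encode[of "gn_tm (subst_tm (sub t m k) s1)" "gn_tm (subst_tm (sub t m k) s2)"]
      gn_tm_le_subst_tm[of k s1 t m] gn_tm_le_subst_tm[of k s2 t m]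
    by fastforce
next
  case (Le s1 s2)
  then show ?case
    using le_prod_encode[of "gn_tm (subst_tm (sub t m k) s1)" "gn_tm (subst_tm (sub t m k) s2)"]
      gn_tm_le_subst_tm[of k s1 t m] gn_tm_le_subst_tm[of k s2 t m]
    by fastforce
next
  case (Imp A B)
  then show ?case
    using le_prod_encode[of "gn (subst (sub t m k) A)" "gn (subst (sub t m k) B)"]
    by fastforce
next
  case (All A)
  then have "gn_tm t \<le> gn (subst (sub t m (Suc k)) A)"
    by simp
  also have "\<dots> \<le> 4 * gn (subst (sub t m (Suc k)) A) + 4"
    by simp
  finally show ?case
    by (simp add: sub_Suc)
qed simp

lemma subst_tm_cong: "\<forall>i \<in> fv_tm t. \<sigma> i = \<tau> i \<Longrightarrow> subst_tm \<sigma> t = subst_tm \<tau> t"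
  by (induction t) simp_all

lemma subst_cong: "\<forall>i \<in> fv A. \<sigma> i = \<tau> i \<Longrightarrow> subst \<sigma> A = subst \<tau> A"
proof (induction A arbitrary: \<sigma> \<tau>)
  case (Eq s t)
  then show ?case
    using subst_tm_cong[of s \<sigma> \<tau>] subst_tm_cong[of t \<sigma> \<tau>] by simp
next
  case (Le s t)
  then show ?case
    using subst_tm_cong[of s \<sigma> \<tau>] subst_tm_cong[of t \<sigma> \<tau>] by simp
next
  case (Imp A B)
  then show ?case
    using Imp.IH(1)[of \<sigma> \<tau>] Imp.IH(2)[of \<sigma> \<tau>] by simp
next
  case (All A)
  have "\<forall>i \<in> fv A. case_nat (Var 0) (\<lambda>i. lift_tm (\<sigma> i)) i = case_nat (Var 0) (\<lambda>i. lift_tm (\<tau> i)) i"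
  proof
    fix i assume "i \<in> fv A"
    then show "case_nat (Var 0) (\<lambda>i. lift_tm (\<sigma> i)) i = case_nat (Var 0) (\<lambda>i. lift_tm (\<tau> i)) i"
      using All.prems by (cases i) simp_all
  qed
  from All.IH[OF this] show ?case by simp
qed simp

lemma small_instance: "\<exists>s. gn_tm s \<le> gn (inst [t] A) \<and> inst [t] A = inst [s] A"
proof (cases "0 \<in> fv A")
  case True
  then show ?thesis
    using gn_tm_le_subst[of 0 A t 0] by (auto simp: subst_sub)
next
  case False
  then have "subst (sub t 0 0) A = subst (sub Zero 0 0) A"
    by (intro subst_cong ballI) (auto simp: sub_def)
  then show ?thesis
    by (intro exI[of _ Zero]) (simp add: subst_sub)
qed

lemma gn_le:
  "gn A \<le> gn (Imp A B)" "gn B \<le> gn (Imp A B)" "gn A \<le> gn (fm.All A)"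
  using le_prod_encode[of "gn A" "gn B"] by simp_all

lemma sat_Logical_axiom:
  assumes x: "val e x = gn C"
  shows "sat e (Logical_axiom x) \<longleftrightarrow> C \<in> logical_axioms"
proof -
  have "sat e (Logical_axiom x) \<longleftrightarrow> (\<exists>A B D. (gn A \<le> gn C \<and> gn B \<le> gn C \<and> gn D \<le> gn C) \<and>
     (C = Imp A (Imp B A) \<or>
      C = Imp (Imp A (Imp B D)) (Imp (Imp A B) (Imp A D)) \<or>
      C = Imp (Imp (Imp A Fls) Fls) A \<or>
      C = Imp (fm.All A) B \<and> (\<exists>t. gn D = gn_tm t \<and> B = inst [t] A) \<or>
      C = Imp (fm.All (Imp A B)) (Imp (fm.All A) (fm.All B)) \<or>
      C = Imp A (fm.All B) \<and> B = lift A \<or>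
      gn C = 4 * prod_encode (gn A, gn A) + 1 \<or>
      C = Imp (Eq (Var 0) (Var 1)) (Imp A B) \<and> B = rename_fm A))" (is "_ = (\<exists>A B D. ?bd A B D \<and> ?ax A B D)")
    unfolding Logical_axiom_def Let_def
    by (simp del: sat_connectives(7) gn.simps One_nat_def
          add: sat_BEx_fm x gn_fold sat_Subst_inst sat_Subst_lift)
  also have "\<dots> \<longleftrightarrow> C \<in> logical_axioms"
  proof
    assume "C \<in> logical_axioms"
    then show "\<exists>A B D. ?bd A B D \<and> ?ax A B D"
    proof cases
      case (4 A t)
      obtain s where s: "gn_tm s \<le> gn (inst [t] A)" "inst [t] A = inst [s] A"
        using small_instance by blast
      obtain D where D: "gn D = gn_tm s"
        using surj_gn by blast
      then have "?bd A (inst [t] A) D"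
        unfolding 4 using s(1) gn_le(1)[of "fm.All A" "inst [t] A"] gn_le(2)[of "inst [t] A" "fm.All A"] gn_le(3)[of A]
        by (simp del: gn.simps)
      then show ?thesis
        using 4 s D by blast
    next
      case (7 t)
      obtain A where A: "gn A = gn_tm t"
        using surj_gn by blast
      then have "?bd A A A" "gn C = 4 * prod_encode (gn A, gn A) + 1"
        using 7 le_prod_encode[of "gn_tm t" "gn_tm t"] by simp_all
      then show ?thesis by blast
    next
      case (1 A B)
      then have "?bd A B B" using gn_le by (meson order_trans)
      then show ?thesis using 1 by blast
    next
      case (2 A B D)
      then have "?bd A B D" using gn_le by (meson order_trans)
      then show ?thesis using 2 by blast
    next
      case (3 A)
      then have "?bd A A A" using gn_le by (meson order_trans)
      then show ?thesis using 3 unfolding Neg_def by blast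
    next
      case (5 A B)
      then have "?bd A B B" using gn_le by (meson order_trans)
      then show ?thesis using 5 by blast
    next
      case (6 A)
      then have "?bd A (lift A) A" using gn_le by (meson order_trans)
      then show ?thesis using 6 by blast
    next
      case (8 A)
      then have "?bd A (rename_fm A) A" using gn_le by (meson order_trans)
      then show ?thesis using 8 by blast
    qed
  next
    assume "\<exists>A B D. ?bd A B D \<and> ?ax A B D"
    then obtain A B D where "?ax A B D" by blast
    moreover have "C \<in> logical_axioms" if "gn C = 4 * prod_encode (gn A, gn A) + 1"
    proof -
      obtain t where "gn_tm t = gn A"
        using surj_gn_tm by blast
      then have "gn C = gn (Eq t t)"
        using that by simp
      then have "C = Eq t t"
        by (simp only: gn_inject)
      then show ?thesis
        by (auto intro: logical_axioms.intros)
    qed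
    ultimately show "C \<in> logical_axioms"
      using logical_axioms.intros unfolding Neg_def by blast
  qed
  finally show ?thesis .
qed

lemma list_encode_le:
  "x \<le> list_encode (x # xs)" "list_encode xs < list_encode (x # xs)"
  using le_prod_encode[of x "list_encode xs"] by simp_all

lemma surj_gn_list: "\<exists>ps. n = list_encode (map gn ps)"
proof -
  have "\<forall>m \<in> set (list_decode n). \<exists>A. m = gn A"
    by (intro ballI) (metis surj_gn)
  then obtain ps where "list_decode n = map gn ps"
    unfolding ex_map_conv[symmetric] by blast
  then show ?thesis
    by (metis list_decode_inverse)
qed

lemma map_gn_inject [simp]: "map gn ps = map gn qs \<longleftrightarrow> ps = qs"
  by (rule inj_map_eq_map) (simp add: inj_def)

lemma gn_less_list_encode:
  "A \<in> set ps \<Longrightarrow> gn A < list_encode (map gn ps)"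
proof (induction ps)
  case (Cons B ps)
  then show ?case
    using le_prod_encode[of "gn B" "list_encode (map gn ps)"] by auto
qed simp

lemma sat_List_mem:
  assumes q: "val e q = list_encode xs"
  shows "sat e (List_mem b q) \<longleftrightarrow> val e b \<in> set xs"
proof -
  let ?q = "val e q" and ?b = "val e b"
  let ?P = "\<lambda>S. ?q \<in> S \<and> (\<forall>f \<le> ?q. f \<in> S \<longrightarrow>
     (\<exists>x \<le> f. \<exists>r \<le> f. f = Suc (prod_encode (x, r)) \<and> (x = ?b \<or> r \<in> S)))"
  have "sat e (List_mem b q) \<longleftrightarrow> (\<exists>s \<le> 2 ^ Suc ?q. ?P (set_decode s))"
    by (simp add: List_mem_def)
  also have "\<dots> \<longleftrightarrow> ?b \<in> set xs"
  proof
    assume "\<exists>s \<le> 2 ^ Suc ?q. ?P (set_decode s)"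
    then obtain S where S: "?P S" by blast
    have "list_encode ys \<in> S \<Longrightarrow> list_encode ys \<le> ?q \<Longrightarrow> ?b \<in> set ys" for ys
    proof (induction ys)
      case (Cons y ys)
      with S obtain x r where
        "list_encode (y # ys) = Suc (prod_encode (x, r))" "x = ?b \<or> r \<in> S"
        by blast
      then have "y = ?b \<or> list_encode ys \<in> S" by simp
      then show ?case
        using Cons list_encode_le[where x = y and xs = ys] by auto
    qed (use S in fastforce)
    then show "?b \<in> set xs" using S q by simp
  next
    assume b: "?b \<in> set xs"
    let ?S = "{list_encode ys | ys. ?b \<in> set ys \<and> list_encode ys \<le> ?q}"
    show "\<exists>s \<le> 2 ^ Suc ?q. ?P (set_decode s)"
    proof (rule ex_certificate)
      show "?S \<subseteq> {..?q}" by auto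
      have "\<exists>x \<le> f. \<exists>r \<le> f. f = Suc (prod_encode (x, r)) \<and> (x = ?b \<or> r \<in> ?S)" if f: "f \<in> ?S" for f
      proof -
        obtain ys where ys: "f = list_encode ys" "?b \<in> set ys" "f \<le> ?q" using f by auto
        then obtain y zs where zs: "ys = y # zs" by (cases ys) auto
        then have "y \<le> f" "list_encode zs \<le> f" "f = Suc (prod_encode (y, list_encode zs))"
          using ys list_encode_le[where x = y and xs = zs] by simp_all
        moreover have "y = ?b \<or> list_encode zs \<in> ?S"
          using ys zs \<open>list_encode zs \<le> f\<close> by (auto intro: order_trans)
        ultimately show ?thesis by blast
      qed
      then show "?P ?S" using b q by auto
    qed
  qed
  finally show ?thesis .
qed

lemma sat_Justified:
  assumes x: "val e x = gn A" and q: "val e q = list_encode (map gn ps)"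
  shows "sat e (Justified F x q) \<longleftrightarrow>
     A \<in> logical_axioms \<or> sat e F \<or> (\<exists>B \<in> set ps. Imp B A \<in> set ps) \<or> (\<exists>B \<in> set ps. A = fm.All B)"
proof -
  have mem: "gn B \<in> gn ` set ps \<longleftrightarrow> B \<in> set ps" for B
    by auto
  have "sat e (Justified F x q) \<longleftrightarrow> A \<in> logical_axioms \<or> sat e F \<or>
     (\<exists>B. gn B \<le> list_encode (map gn ps) \<and> B \<in> set ps \<and> Imp B A \<in> set ps) \<or>
     (\<exists>B. gn B \<le> list_encode (map gn ps) \<and> B \<in> set ps \<and> A = fm.All B)"
    unfolding Justified_def
    by (simp del: sat_connectives(7) gn.simps
        add: sat_BEx_fm x q gn_fold sat_List_mem[where xs = "map gn ps"] sat_Logical_axiom[where C = A] mem)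
  then show ?thesis
    using gn_less_list_encode[of _ ps] less_imp_le by blast
qed

lemma sat_Derivation:
  assumes X: "\<And>r A f s. sat (case_nat r (case_nat (gn A) (case_nat f (case_nat s e)))) (X (Var 1))
      \<longleftrightarrow> A \<in> T"
    and p: "val e p = list_encode (map gn ps)"
  shows "sat e (Derivation X p) \<longleftrightarrow> derivation T ps"
proof -
  let ?p = "val e p"
  let ?J = "\<lambda>S A qs. (list_encode (map gn qs) \<in> S \<and>
     (A \<in> logical_axioms \<or> A \<in> T \<or> (\<exists>B \<in> set qs. Imp B A \<in> set qs) \<or> (\<exists>B \<in> set qs. A = fm.All B)))"
  let ?P = "\<lambda>S. ?p \<in> S \<and> (\<forall>f \<le> ?p. f \<in> S \<longrightarrow> f = 0 \<or>
     (\<exists>A qs. f = list_encode (map gn (A # qs)) \<and> ?J S A qs))"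
  have list: "\<exists>qs. n = list_encode (map gn qs)" for n
    by (rule surj_gn_list)
  have clause: "(\<exists>x \<le> f. \<exists>r \<le> f. (f = Suc (prod_encode (x, r)) \<and> r \<in> set_decode s) \<and>
        sat (case_nat r (case_nat x (case_nat f (case_nat s e)))) (Justified (X (Var 1)) (Var 1) (Var 0)))
     \<longleftrightarrow> (\<exists>A qs. f = list_encode (map gn (A # qs)) \<and> ?J (set_decode s) A qs)" (is "?l \<longleftrightarrow> ?r") for f s
  proof
    assume ?l
    then obtain x r where xr: "f = Suc (prod_encode (x, r))" "r \<in> set_decode s"
        "sat (case_nat r (case_nat x (case_nat f (case_nat s e)))) (Justified (X (Var 1)) (Var 1) (Var 0))"
      by blast
    obtain A qs where "x = gn A" "r = list_encode (map gn qs)"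
      using surj_gn list by metis
    moreover from this have "sat (case_nat r (case_nat x (case_nat f (case_nat s e)))) (X (Var 1)) \<longleftrightarrow> A \<in> T"
      using X by simp
    moreover note sat_Justified[of "case_nat r (case_nat x (case_nat f (case_nat s e)))" "Var 1" A "Var 0" qs "X (Var 1)"]
    ultimately have "?J (set_decode s) A qs"
      using xr by simp
    moreover have "f = list_encode (map gn (A # qs))"
      using xr(1) \<open>x = gn A\<close> \<open>r = _\<close> by simp
    ultimately show ?r by blast
  next
    assume ?r
    then obtain A qs where *: "f = list_encode (map gn (A # qs))" "?J (set_decode s) A qs"
      by blast
    have "gn A \<le> f" "list_encode (map gn qs) \<le> f"
      using *(1) list_encode_le[where x = "gn A" and xs = "map gn qs"] by simp_all
    moreover have "f = Suc (prod_encode (gn A, list_encode (map gn qs)))"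
      using *(1) by simp
    moreover have "sat (case_nat (list_encode (map gn qs)) (case_nat (gn A) (case_nat f (case_nat s e))))
        (Justified (X (Var 1)) (Var 1) (Var 0))"
      using *(2) X[of "list_encode (map gn qs)" A f s]
        sat_Justified[of "case_nat (list_encode (map gn qs)) (case_nat (gn A) (case_nat f (case_nat s e)))"
          "Var 1" A "Var 0" qs "X (Var 1)"]
      by simp
    ultimately show ?l
      using *(2) by blast
  qed
  have "sat e (Derivation X p) \<longleftrightarrow> (\<exists>s \<le> 2 ^ Suc ?p. ?P (set_decode s))"
    unfolding clause[symmetric] by (simp add: Derivation_def)
  also have "\<dots> \<longleftrightarrow> derivation T ps"
  proof
    assume "\<exists>s \<le> 2 ^ Suc ?p. ?P (set_decode s)"
    then obtain S where S: "?P S" by blast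
    have "list_encode (map gn qs) \<in> S \<Longrightarrow> list_encode (map gn qs) \<le> ?p \<Longrightarrow> derivation T qs" for qs
    proof (induction qs)
      case (Cons A qs)
      have "list_encode (map gn (A # qs)) \<noteq> 0"
        by simp
      with S[THEN conjunct2, rule_format, OF Cons.prems(2,1)] obtain B rs where
        "list_encode (map gn (A # qs)) = list_encode (map gn (B # rs))" and J: "?J S B rs"
        by (elim disjE exE conjE) simp_all
      then have "map gn (A # qs) = map gn (B # rs)"
        by (simp only: list_encode_eq)
      then have J: "?J S A qs"
        using J by simp
      moreover have "list_encode (map gn qs) \<le> ?p"
        using Cons.prems(2) list_encode_le(2)[of "map gn qs" "gn A"] by simp
      ultimately show ?case
        using Cons.IH by simp
    qed simp
    then show "derivation T ps" using S p by simp
  next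
    assume ps: "derivation T ps"
    let ?S = "{list_encode (map gn qs) | qs. derivation T qs \<and> list_encode (map gn qs) \<le> ?p}"
    show "\<exists>s \<le> 2 ^ Suc ?p. ?P (set_decode s)"
    proof (rule ex_certificate)
      show "?S \<subseteq> {..?p}" by auto
      have "f = 0 \<or> (\<exists>A qs. f = list_encode (map gn (A # qs)) \<and> ?J ?S A qs)" if f: "f \<in> ?S" for f
      proof -
        obtain qs where qs: "f = list_encode (map gn qs)" "derivation T qs" "f \<le> ?p"
          using f by auto
        show ?thesis
        proof (cases qs)
          case (Cons A rs)
          then have "list_encode (map gn rs) \<le> ?p"
            using qs list_encode_le(2)[of "map gn rs" "gn A"] by simp
          then have "?J ?S A rs" using qs Cons by auto
          then show ?thesis using qs Cons by blast
        qed (use qs in simp)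
      qed
      moreover have "?p \<in> ?S"
        unfolding mem_Collect_eq using ps p by (intro exI[of _ ps]) simp
      ultimately show "?P ?S" by simp
    qed
  qed
  finally show ?thesis .
qed

lemma sat_Proof:
  assumes X: "\<And>r A f s. sat (case_nat r (case_nat (gn A) (case_nat f (case_nat s e)))) (X (Var 1))
      \<longleftrightarrow> A \<in> T"
    and y: "val e y = gn A"
  shows "sat e (Proof X p y) \<longleftrightarrow> codes_proof T (val e p) A"
proof -
  have *: "\<exists>qs. n = list_encode (map gn qs)" for n
    by (rule surj_gn_list)
  obtain ps where ps: "val e p = list_encode (map gn ps)"
    using * by blast
  have "sat e (Proof X p y) \<longleftrightarrow> (\<exists>r \<le> val e p. val e p = Suc (prod_encode (gn A, r))) \<and> derivation T ps"
    using sat_Derivation[of e X T p ps] X ps by (simp add: Proof_def y)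
  also have "\<dots> \<longleftrightarrow> (\<exists>qs. val e p = list_encode (map gn (A # qs))) \<and> derivation T ps"
  proof -
    have "(\<exists>r \<le> val e p. val e p = Suc (prod_encode (gn A, r))) \<longleftrightarrow>
        (\<exists>qs. val e p = list_encode (map gn (A # qs)))"
    proof
      assume "\<exists>r \<le> val e p. val e p = Suc (prod_encode (gn A, r))"
      then obtain r where r: "val e p = Suc (prod_encode (gn A, r))" by blast
      obtain qs where "r = list_encode (map gn qs)" using * by blast
      with r show "\<exists>qs. val e p = list_encode (map gn (A # qs))"
        by (intro exI[of _ qs]) simp
    next
      assume "\<exists>qs. val e p = list_encode (map gn (A # qs))"
      then obtain qs where qs: "val e p = list_encode (map gn (A # qs))" by blast
      then show "\<exists>r \<le> val e p. val e p = Suc (prod_encode (gn A, r))"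
        using list_encode_le(2)[of "map gn qs" "gn A"]
        by (intro exI[of _ "list_encode (map gn qs)"]) simp
    qed
    then show ?thesis by simp
  qed
  also have "\<dots> \<longleftrightarrow> codes_proof T (val e p) A"
  proof -
    have "ps = A # qs" if "val e p = list_encode (map gn (A # qs))" for qs
    proof -
      have "map gn ps = map gn (A # qs)"
        using ps that by (simp only: list_encode_eq)
      then show ?thesis by (simp only: map_gn_inject)
    qed
    then show ?thesis unfolding codes_proof_def using ps by blast
  qed
  finally show ?thesis .
qed

lemma sat_inst_single:
  assumes "fv \<alpha> \<subseteq> {0}"
  shows "sat e (inst [t] \<alpha>) \<longleftrightarrow> sat (\<lambda>_. val e t) \<alpha>"
  unfolding inst_def sat_subst using assms by (intro sat_cong) auto

text \<open>The formulas satisfying \<open>\<alpha>\<close>.\<close>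

definition extension :: "fm \<Rightarrow> fm set" where
  "extension \<alpha> = {A. holds (inst [\<ulcorner>A\<urcorner>] \<alpha>)}"

lemma sat_inst_extension:
  assumes "fv \<alpha> \<subseteq> {0}" "val e t = gn A"
  shows "sat e (inst [t] \<alpha>) \<longleftrightarrow> A \<in> extension \<alpha>"
  using assms by (simp add: sat_inst_single extension_def holds_def)

lemma sat_Prf:
  assumes "fv \<alpha> \<subseteq> {0}" "val e y = gn A"
  shows "sat e (Prf \<alpha> p y) \<longleftrightarrow> codes_proof (extension \<alpha>) (val e p) A"
  unfolding Prf_def by (rule sat_Proof[OF sat_inst_extension[OF assms(1)] assms(2)]) simp

lemma sat_Prf_from:
  assumes "fv \<alpha> \<subseteq> {0}" "val e y = gn A" "val e z = gn B"
  shows "sat e (Prf_from \<alpha> z p y) \<longleftrightarrow> codes_proof (insert B (extension \<alpha>)) (val e p) A"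
  unfolding Prf_from_def
proof (rule sat_Proof[OF _ assms(2)])
  fix r C f s
  let ?e = "case_nat r (case_nat (gn C) (case_nat f (case_nat s e)))"
  have "sat ?e (inst [Var 1] \<alpha>) \<longleftrightarrow> C \<in> extension \<alpha>"
    by (rule sat_inst_extension[OF assms(1)]) simp
  then show "sat ?e (Disj (inst [Var 1] \<alpha>) (Eq (Var 1) (L 4 z))) \<longleftrightarrow> C \<in> insert B (extension \<alpha>)"
    using assms(3) by auto
qed

lemma sat_Prov:
  assumes "fv \<alpha> \<subseteq> {0}" "val e y = gn A"
  shows "sat e (Prov \<alpha> y) \<longleftrightarrow> extension \<alpha> \<turnstile> A"
  using assms(2) by (simp add: Prov_def sat_Prf[OF assms(1), where A = A] codes_proof_def proves_def)

lemma sat_Box: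
  assumes "fv \<alpha> \<subseteq> {0}" "val e y = gn A"
  shows "sat e (Box \<alpha> x y) \<longleftrightarrow> (\<exists>p \<le> val e x. codes_proof (extension \<alpha>) p A)"
  using assms(2) by (simp add: Box_def sat_Prf[OF assms(1), where A = A])

lemma sat_Box_from:
  assumes "fv \<alpha> \<subseteq> {0}" "val e y = gn A" "val e z = gn B"
  shows "sat e (Box_from \<alpha> z x y) \<longleftrightarrow> (\<exists>p \<le> val e x. codes_proof (insert B (extension \<alpha>)) p A)"
  using assms(2,3) by (simp add: Box_from_def sat_Prf_from[OF assms(1), where A = A and B = B])

lemma sat_Induction:
  assumes x: "val e x = gn C"
  shows "sat e (Induction x) \<longleftrightarrow> (\<exists>A. C = induction_fm A)"
proof -
  have "sat e (Induction x) \<longleftrightarrow> (\<exists>A B D. (gn A \<le> gn C \<and> gn B \<le> gn C \<and> gn D \<le> gn C) \<and>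
     C = Imp B (Imp (fm.All (Imp A D)) (fm.All A)) \<and> B = inst [Zero] A \<and> D = succ_fm A)"
    (is "_ = (\<exists>A B D. ?bd A B D \<and> ?ax A B D)")
    unfolding Induction_def Let_def
    by (simp del: sat_connectives(7) gn.simps One_nat_def
          add: sat_BEx_fm x gn_fold sat_Subst[where ?u0.0 = Zero] subst_sub sat_Subst_lift cong: conj_cong)
  also have "\<dots> \<longleftrightarrow> (\<exists>A. C = induction_fm A)"
  proof
    assume "\<exists>A. C = induction_fm A"
    then obtain A where A: "?ax A (inst [Zero] A) (succ_fm A)"
      unfolding induction_fm_def by blast
    then have "?bd A (inst [Zero] A) (succ_fm A)"
      using gn_le by (metis order_trans)
    with A show "\<exists>A B D. ?bd A B D \<and> ?ax A B D" by blast
  qed (auto simp: induction_fm_def)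
  finally show ?thesis .
qed

lemma sat_Induction_closure:
  assumes x: "val e x = gn C"
  shows "sat e (Induction_closure x) \<longleftrightarrow> (\<exists>n A. C = (fm.All ^^ n) (induction_fm A))"
proof -
  let ?P = "\<lambda>S. gn C \<in> S \<and> (\<forall>B. gn B \<le> gn C \<longrightarrow> gn B \<in> S \<longrightarrow>
     (\<exists>A. B = induction_fm A) \<or> (\<exists>A. B = fm.All A \<and> gn A \<in> S))"
  have BAll_fm: "sat e (BAll t A) \<longleftrightarrow> (\<forall>B. gn B \<le> val e t \<longrightarrow> sat (case_nat (gn B) e) A)" for e t A
    by simp (metis surj_gn)
  have "sat e (Induction_closure x) \<longleftrightarrow> (\<exists>s \<le> 2 ^ Suc (gn C). gn C \<in> set_decode s \<and>
      (\<forall>B. gn B \<le> gn C \<longrightarrow> gn B \<in> set_decode s \<longrightarrow> (\<exists>A. B = induction_fm A) \<or>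
        (\<exists>r \<le> gn B. gn B = 4 * r + 4 \<and> r \<in> set_decode s)))"
    unfolding Induction_closure_def by (simp add: BAll_fm x sat_Induction del: sat_connectives(6))
  also have "\<dots> \<longleftrightarrow> (\<exists>s \<le> 2 ^ Suc (gn C). ?P (set_decode s))"
  proof -
    have "(\<exists>r \<le> gn B. gn B = 4 * r + 4 \<and> r \<in> S) \<longleftrightarrow> (\<exists>A. B = fm.All A \<and> gn A \<in> S)" for B S
    proof
      assume "\<exists>r \<le> gn B. gn B = 4 * r + 4 \<and> r \<in> S"
      then obtain A where "gn B = gn (fm.All A)" "gn A \<in> S"
        using surj_gn by (metis gn.simps(5))
      then show "\<exists>A. B = fm.All A \<and> gn A \<in> S"
        by (simp only: gn_inject) blast
    qed auto
    then show ?thesis by simp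
  qed
  also have "\<dots> \<longleftrightarrow> (\<exists>n A. C = (fm.All ^^ n) (induction_fm A))"
  proof
    assume "\<exists>s \<le> 2 ^ Suc (gn C). ?P (set_decode s)"
    then obtain S where S: "?P S" by blast
    have "gn B \<in> S \<Longrightarrow> gn B \<le> gn C \<Longrightarrow> \<exists>n A. B = (fm.All ^^ n) (induction_fm A)" for B
    proof (induction B rule: measure_induct_rule[of gn])
      case (less B)
      then consider A where "B = induction_fm A" | A where "B = fm.All A" "gn A \<in> S"
        using S by blast
      then show ?case
      proof cases
        case 1
        then show ?thesis by (metis funpow_0)
      next
        case 2
        then obtain n A' where "A = (fm.All ^^ n) (induction_fm A')"
          using less.IH[of A] less.prems by auto
        then have "B = (fm.All ^^ Suc n) (induction_fm A')"
          using 2 by simp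
        then show ?thesis by blast
      qed
    qed
    then show "\<exists>n A. C = (fm.All ^^ n) (induction_fm A)"
      using S by blast
  next
    assume C: "\<exists>n A. C = (fm.All ^^ n) (induction_fm A)"
    let ?S = "{gn B | B. gn B \<le> gn C \<and> (\<exists>n A. B = (fm.All ^^ n) (induction_fm A))}"
    show "\<exists>s \<le> 2 ^ Suc (gn C). ?P (set_decode s)"
    proof (rule ex_certificate)
      show "?S \<subseteq> {..gn C}" by auto
      have "(\<exists>A. B = induction_fm A) \<or> (\<exists>A. B = fm.All A \<and> gn A \<in> ?S)" if "gn B \<in> ?S" for B
      proof -
        have "gn B \<le> gn C \<and> (\<exists>n A. B = (fm.All ^^ n) (induction_fm A))"
          using that by (simp only: mem_Collect_eq gn_inject) blast
        then obtain n A where n: "B = (fm.All ^^ n) (induction_fm A)" "gn B \<le> gn C"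
          by blast
        show ?thesis
        proof (cases n)
          case (Suc m)
          then have B: "B = fm.All ((fm.All ^^ m) (induction_fm A))"
            using n by simp
          then have "gn ((fm.All ^^ m) (induction_fm A)) \<le> gn C"
            using n(2) gn_le(3) order_trans by blast
          then show ?thesis using B by blast
        qed (use n in auto)
      qed
      then show "?P ?S" using C by blast
    qed
  qed
  finally show ?thesis .
qed

lemma extension_PA_axiom: "extension PA_axiom = PA"
proof -
  have "sat e (foldr (\<lambda>A. Disj (Eq (Var 0) \<ulcorner>A\<urcorner>)) As Fls) \<longleftrightarrow> A \<in> set As"
    if "e 0 = gn A" for e A As
    using that by (induction As) auto
  then have "holds (inst [\<ulcorner>A\<urcorner>] PA_axiom) \<longleftrightarrow> A \<in> PA" for A
    unfolding holds_def inst_def sat_subst PA_axiom_def PA_def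
    by (auto simp: sat_Sent[where A = A] sat_Induction_closure[where C = A])
  then show ?thesis
    by (auto simp: extension_def)
qed

text \<open>\<open>of_set n S\<close> is a valuation that agrees with \<open>S\<close> on the formulas with codes up to \<open>n\<close>.\<close>

primrec of_set :: "nat \<Rightarrow> nat set \<Rightarrow> fm \<Rightarrow> bool" where
  "of_set n S (Eq s t) \<longleftrightarrow> gn (Eq s t) \<in> S"
| "of_set n S (Le s t) \<longleftrightarrow> gn (Le s t) \<in> S"
| "of_set n S Fls \<longleftrightarrow> False"
| "of_set n S (Imp A B) \<longleftrightarrow> (of_set n S A \<longrightarrow> of_set n S B)"
| "of_set n S (All A) \<longleftrightarrow> gn (All A) \<in> S"

lemma gn_Imp_le: "gn (Imp A B) \<le> n \<Longrightarrow> gn A \<le> n \<and> gn B \<le> n"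
  using gn_le(1)[of A B] gn_le(2)[of B A] by simp

lemma of_set:
  assumes "gn Fls \<notin> S"
    and "\<And>A B. gn (Imp A B) \<le> n \<Longrightarrow> gn (Imp A B) \<in> S \<longleftrightarrow> (gn A \<in> S \<longrightarrow> gn B \<in> S)"
  shows "gn A \<le> n \<Longrightarrow> of_set n S A \<longleftrightarrow> gn A \<in> S"
proof (induction A)
  case (Imp A B)
  then have "gn A \<le> n" "gn B \<le> n"
    using gn_Imp_le by blast+
  then show ?case
    using Imp assms(2)[of A B] by simp
qed (use assms(1) in simp_all)

lemma sat_Valuation:
  "sat e (Valuation v x) \<longleftrightarrow> gn Fls \<notin> set_decode (val e v) \<and>
     (\<forall>A B. gn (Imp A B) \<le> val e x \<longrightarrow>
       (gn (Imp A B) \<in> set_decode (val e v) \<longleftrightarrow>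
         (gn A \<in> set_decode (val e v) \<longrightarrow> gn B \<in> set_decode (val e v))))"
proof -
  have BAll_fm: "sat e (BAll t A) \<longleftrightarrow> (\<forall>B. gn B \<le> val e t \<longrightarrow> sat (case_nat (gn B) e) A)" for e t A
    by simp (metis surj_gn)
  have "sat e (Valuation v x) \<longleftrightarrow> gn Fls \<notin> set_decode (val e v) \<and>
     (\<forall>A. gn A \<le> val e x \<longrightarrow> (\<forall>B. gn B \<le> val e x \<longrightarrow> gn (Imp A B) \<le> val e x \<longrightarrow>
       (gn (Imp A B) \<in> set_decode (val e v) \<longleftrightarrow>
         (gn A \<in> set_decode (val e v) \<longrightarrow> gn B \<in> set_decode (val e v)))))"
    unfolding Valuation_def
    by (simp add: BAll_fm gn_fold del: sat_connectives(6) gn.simps)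
  then show ?thesis
    by (metis gn_Imp_le)
qed

lemma sat_Follows:
  assumes \<alpha>: "fv \<alpha> \<subseteq> {0}" and a: "val e a = gn A" and b: "val e b = gn B"
  shows "sat e (Follows \<alpha> x a b) \<longleftrightarrow> follows (extension \<alpha>) (val e x) A B"
proof -
  let ?n = "val e x"
  let ?T = "\<lambda>C. sentence C \<and> (\<exists>p \<le> ?n. codes_proof (extension \<alpha>) p C)"
  let ?V = "\<lambda>S. gn Fls \<notin> S \<and>
     (\<forall>A B. gn (Imp A B) \<le> ?n \<longrightarrow> (gn (Imp A B) \<in> S \<longleftrightarrow> (gn A \<in> S \<longrightarrow> gn B \<in> S)))"
  let ?P = "\<lambda>S. ?V S \<and> gn A \<in> S \<and> (\<forall>C. gn C \<le> ?n \<longrightarrow> ?T C \<longrightarrow> gn C \<in> S) \<longrightarrow> gn B \<in> S"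
  have BAll_fm: "(\<forall>c \<le> n. P c) \<longleftrightarrow> (\<forall>C. gn C \<le> n \<longrightarrow> P (gn C))" for n P
    by (metis surj_gn)
  have T_le: "gn C \<le> ?n" if "?T C" for C
  proof -
    obtain p ps where "p \<le> ?n" "p = list_encode (map gn (C # ps))"
      using \<open>?T C\<close> codes_proof_def by auto
    then show ?thesis
      using gn_less_list_encode[of C "C # ps"] by (auto simp del: list_encode.simps)
  qed
  have *: "sat e (Follows \<alpha> x a b) \<longleftrightarrow> sentence A \<and> sentence B \<and> gn A \<le> ?n \<and> gn B \<le> ?n \<and>
     (\<forall>s \<le> 2 ^ Suc ?n. ?P (set_decode s))"
    unfolding Follows_def
    by (simp add: BAll_fm[where n = ?n] a b sat_Sent sat_Valuation sat_Box[OF \<alpha>] del: gn.simps)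
  have **: "(\<forall>s \<le> 2 ^ Suc ?n. ?P (set_decode s)) \<longleftrightarrow>
     (\<forall>v. valuation v \<and> v A \<and> (\<forall>C. ?T C \<longrightarrow> v C) \<longrightarrow> v B)"
    if AB: "gn A \<le> ?n" "gn B \<le> ?n"
  proof
    assume P: "\<forall>s \<le> 2 ^ Suc ?n. ?P (set_decode s)"
    show "\<forall>v. valuation v \<and> v A \<and> (\<forall>C. ?T C \<longrightarrow> v C) \<longrightarrow> v B"
    proof (intro allI impI)
      fix v assume v: "valuation v \<and> v A \<and> (\<forall>C. ?T C \<longrightarrow> v C)"
      let ?S = "{gn C | C. gn C \<le> ?n \<and> v C}"
      have S: "gn C \<in> ?S \<longleftrightarrow> gn C \<le> ?n \<and> v C" for C
        by auto
      have sub: "?S \<subseteq> {..?n}" by auto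
      have "?P (set_decode (set_encode ?S))"
        using P[rule_format, OF set_encode_bound(1)[OF sub]] by (rule impI)
      then have "?P ?S"
        by (simp only: set_encode_bound(2)[OF sub])
      moreover have "?V ?S"
        using v gn_Imp_le unfolding S valuation_def by metis
      ultimately show "v B"
        using v AB unfolding S by blast
    qed
  next
    assume v: "\<forall>v. valuation v \<and> v A \<and> (\<forall>C. ?T C \<longrightarrow> v C) \<longrightarrow> v B"
    show "\<forall>s \<le> 2 ^ Suc ?n. ?P (set_decode s)"
    proof (intro allI impI)
      fix s
      let ?S = "set_decode s"
      assume S: "?V ?S \<and> gn A \<in> ?S \<and> (\<forall>C. gn C \<le> ?n \<longrightarrow> ?T C \<longrightarrow> gn C \<in> ?S)"
      have *: "of_set ?n ?S C \<longleftrightarrow> gn C \<in> ?S" if "gn C \<le> ?n" for C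
        using of_set[of ?S ?n C] S that by blast
      have "valuation (of_set ?n ?S)"
        by (simp add: valuation_def)
      then show "gn B \<in> ?S"
        using v S * AB T_le by blast
    qed
  qed
  show ?thesis
  proof (cases "gn A \<le> ?n \<and> gn B \<le> ?n")
    case True
    then show ?thesis
      by (simp only: * follows_def **[OF True[THEN conjunct1] True[THEN conjunct2]])
  next
    case False
    then show ?thesis
      by (simp only: * follows_def) blast
  qed
qed

lemma sat_Black_box:
  assumes \<alpha>: "fv \<alpha> \<subseteq> {0}" and z: "val e z = gn A" and y: "val e y = gn B"
  shows "sat e (Black_box \<alpha> z x y) \<longleftrightarrow>
    (\<exists>C. gn C \<le> val e x \<and> follows (extension \<alpha>) (val e x) A C \<and>
       (\<exists>p \<le> val e x. codes_proof (insert C (extension \<alpha>)) p B))"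
  unfolding Black_box_def
  by (simp add: sat_BEx_fm sat_Follows[OF \<alpha>, where A = A] sat_Box_from[OF \<alpha>, where A = B] z y
        del: sat_connectives(7))

lemma elementary_connectives [simp, intro]:
  "elementary (Eq s t)"
  "elementary (Le s t)"
  "elementary Fls"
  "elementary A \<Longrightarrow> elementary B \<Longrightarrow> elementary (Imp A B)"
  "elementary A \<Longrightarrow> elementary (Neg A)"
  "elementary A \<Longrightarrow> elementary B \<Longrightarrow> elementary (Conj A B)"
  "elementary A \<Longrightarrow> elementary B \<Longrightarrow> elementary (Disj A B)"
  "elementary A \<Longrightarrow> elementary B \<Longrightarrow> elementary (Iff A B)"
  "elementary A \<Longrightarrow> elementary (BAll t A)"
  "elementary A \<Longrightarrow> elementary (BEx t A)"
  by (auto simp: Neg_def Conj_def Disj_def Iff_def BEx_def intro: elementary.intros)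

lemma elementary_subst: "elementary A \<Longrightarrow> elementary (subst \<sigma> A)"
proof (induction A arbitrary: \<sigma> rule: elementary.induct)
  case (5 A t)
  have "subst \<sigma> (BAll t A) =
      BAll (subst_tm \<sigma> t) (subst (case_nat (Var 0) (\<lambda>i. lift_tm (\<sigma> i))) A)"
    by (simp add: BAll_def lift_tm_def subst_tm_subst_tm)
  then show ?case
    using 5 by simp
qed auto

lemma elementary_inst [simp, intro]: "elementary A \<Longrightarrow> elementary (inst ts A)"
  by (simp add: inst_def elementary_subst)

lemma elementary_Mem [simp, intro]:
  "elementary (Is_Cons u s t)" "elementary (Mem s t)"
  by (simp_all add: Is_Cons_def Mem_def)

lemma elementary_Tm_map: "(\<And>i d. elementary (V i d)) \<Longrightarrow> elementary (Tm_map V a b)"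
  by (simp add: Tm_map_def)

lemma elementary_Shift [simp, intro]: "elementary (Shift k a b)"
  by (simp add: Shift_def elementary_Tm_map)

lemma elementary_Subst_tm [simp, intro]: "elementary (Subst_tm u m k a b)"
  by (simp add: Subst_tm_def elementary_Tm_map)

lemma elementary_Subst [simp, intro]: "elementary (Subst u m a b)"
  by (simp add: Subst_def)

lemma elementary_Sent [simp, intro]: "elementary (Sent a)"
  by (simp add: Sent_def)

lemma elementary_Logical_axiom [simp, intro]: "elementary (Logical_axiom x)"
  by (simp add: Logical_axiom_def Let_def)

lemma elementary_List_mem [simp, intro]: "elementary (List_mem b q)"
  by (simp add: List_mem_def)

lemma elementary_Proof:
  "(\<And>x. elementary (X x)) \<Longrightarrow> elementary (Proof X p y)"
  by (simp add: Proof_def Derivation_def Justified_def)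

lemma elementary_Prf [simp, intro]:
  "elementary \<alpha> \<Longrightarrow> elementary (Prf \<alpha> p y)"
  "elementary \<alpha> \<Longrightarrow> elementary (Prf_from \<alpha> z p y)"
  by (simp_all add: Prf_def Prf_from_def elementary_Proof)

lemma elementary_Follows [simp, intro]:
  "elementary \<alpha> \<Longrightarrow> elementary (Follows \<alpha> x a b)"
  "elementary \<alpha> \<Longrightarrow> elementary (Black_box \<alpha> z x y)"
  by (simp_all add: Follows_def Black_box_def Valuation_def Box_def Box_from_def)

lemma elementary_PA_axiom: "elementary PA_axiom"
proof -
  have "elementary (foldr (\<lambda>A. Disj (Eq (Var 0) \<ulcorner>A\<urcorner>)) As Fls)" for As
    by (induction As) auto
  then show ?thesis
    by (simp add: PA_axiom_def Induction_closure_def Induction_def Let_def)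
qed


end

theory Submission
  imports Defs
begin

text \<open>
  An intermediate sentence witnessing the black box relative to \<open>\<psi>\<close> also serves for \<open>\<phi>\<close>:
  if \<open>x \<ge> p\<close>, then the implication \<open>\<phi> \<longrightarrow> \<psi>\<close> is among the sentences with a proof up to \<open>x\<close>, so every
  valuation that has to be considered and makes \<open>\<phi>\<close> true makes \<open>\<psi>\<close> true. For this argument
  within EA one needs that EA proves all true elementary sentences, in
  particular that \<open>p\<close> codes a proof of the implication. Here \<open>\<alpha>\<close> must define \<open>\<A>\<close> in the standard model,
  which follows from the binumeration and the consistency of \<open>\<A>\<close>.
\<close>

section \<open>Substitution\<close>

text \<open>The substitution that acts under a binder. With a name of its own it is rewritten by its
  own rules, so the equation of \<open>subst\<close> for \<open>All\<close> is replaced below by one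
  that mentions \<open>up\<close>.\<close>

definition up :: "(nat \<Rightarrow> tm) \<Rightarrow> nat \<Rightarrow> tm" where
  "up \<sigma> = case_nat (Var 0) (\<lambda>i. lift_tm (\<sigma> i))"

lemma up_simps [simp]: "up \<sigma> 0 = Var 0" "up \<sigma> (Suc i) = lift_tm (\<sigma> i)"
  by (simp_all add: up_def)

lemma subst_All [simp]: "subst \<sigma> (All A) = All (subst (up \<sigma>) A)"
  by (simp add: up_def)

declare subst.simps(5) [simp del]

lemma lift_tm_simps [simp]:
  "lift_tm (Var i) = Var (Suc i)"
  "lift_tm Zero = Zero"
  "lift_tm (Succ t) = Succ (lift_tm t)"
  "lift_tm (Plus s t) = Plus (lift_tm s) (lift_tm t)"
  "lift_tm (Times s t) = Times (lift_tm s) (lift_tm t)"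
  "lift_tm (Exp2 t) = Exp2 (lift_tm t)"
  by (simp_all add: lift_tm_def)

lemma subst_tm_up_lift [simp]: "subst_tm (up \<sigma>) (lift_tm t) = lift_tm (subst_tm \<sigma> t)"
  by (simp add: lift_tm_def subst_tm_subst_tm)

lemma subst_tm_case_nat_lift [simp]: "subst_tm (case_nat s \<sigma>) (lift_tm t) = subst_tm \<sigma> t"
  by (simp add: lift_tm_def subst_tm_subst_tm)

lemma subst_tm_nm [simp]: "subst_tm \<sigma> (nm n) = nm n"
  by (induction n) simp_all

lemma lift_tm_nm [simp]: "lift_tm (nm n) = nm n"
  by (simp add: lift_tm_def)

lemma fv_tm_nm [simp]: "fv_tm (nm n) = {}"
  by (induction n) simp_all

lemma subst_subst: "subst \<sigma> (subst \<tau> A) = subst (\<lambda>i. subst_tm \<sigma> (\<tau> i)) A"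
proof (induction A arbitrary: \<sigma> \<tau>)
  case (All A)
  have "(\<lambda>i. subst_tm (up \<sigma>) (up \<tau> i)) = up (\<lambda>i. subst_tm \<sigma> (\<tau> i))"
  proof
    show "subst_tm (up \<sigma>) (up \<tau> i) = up (\<lambda>i. subst_tm \<sigma> (\<tau> i)) i" for i
      by (cases i) simp_all
  qed
  then show ?case by (simp add: All)
qed (simp_all add: subst_tm_subst_tm)

lemma up_Var [simp]: "up Var = Var"
proof
  show "up Var i = Var i" for i by (cases i) simp_all
qed

lemma subst_Var [simp]: "subst Var A = A"
  by (induction A) simp_all

lemma case_nat_Var [simp]: "case_nat (Var 0) (\<lambda>i. Var (Suc i)) = Var"
  by (simp add: fun_eq_iff split: nat.split)

lemma inst_single: "inst [t] A = subst (case_nat t Var) A"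
  unfolding inst_def by (rule subst_cong) (simp split: nat.split)

lemma subst_connectives [simp]:
  "subst \<sigma> (Neg A) = Neg (subst \<sigma> A)"
  "subst \<sigma> (Conj A B) = Conj (subst \<sigma> A) (subst \<sigma> B)"
  "subst \<sigma> (Disj A B) = Disj (subst \<sigma> A) (subst \<sigma> B)"
  "subst \<sigma> (Iff A B) = Iff (subst \<sigma> A) (subst \<sigma> B)"
  "subst \<sigma> (BAll t A) = BAll (subst_tm \<sigma> t) (subst (up \<sigma>) A)"
  "subst \<sigma> (BEx t A) = BEx (subst_tm \<sigma> t) (subst (up \<sigma>) A)"
  by (simp_all add: Neg_def Conj_def Disj_def Iff_def BAll_def BEx_def)

lemma finite_fv_tm: "finite (fv_tm t)"
  by (induction t) simp_all

text \<open>Finiteness means that finitely many generalizations close a formula, which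
  \<open>proves_subst\<close> relies on.\<close>

lemma finite_fv: "finite (fv A)"
proof (induction A)
  case (All A)
  have "{i. Suc i \<in> fv A} = Suc -` fv A" by auto
  then show ?case using All by (simp add: finite_vimageI)
qed (simp_all add: finite_fv_tm)

section \<open>The proof system\<close>

lemma derivation_append: "derivation T ps \<Longrightarrow> derivation T qs \<Longrightarrow> derivation T (ps @ qs)"
  by (induction ps) auto

lemma proves_logical_axiom: "A \<in> logical_axioms \<Longrightarrow> T \<turnstile> A"
  unfolding proves_def by (rule exI[of _ "[]"]) simp

lemma proves_assumption: "A \<in> T \<Longrightarrow> T \<turnstile> A"
  unfolding proves_def by (rule exI[of _ "[]"]) simp

lemma proves_mp:
  assumes "T \<turnstile> Imp A B" "T \<turnstile> A"
  shows "T \<turnstile> B"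
proof -
  obtain ps qs where "derivation T (Imp A B # ps)" "derivation T (A # qs)"
    using assms unfolding proves_def by blast
  then have "derivation T ((Imp A B # ps) @ (A # qs))"
    by (rule derivation_append)
  then have "derivation T (B # (Imp A B # ps) @ (A # qs))"
    by auto
  then show ?thesis unfolding proves_def by blast
qed

lemma proves_gen:
  assumes "T \<turnstile> A"
  shows "T \<turnstile> All A"
proof -
  obtain ps where "derivation T (A # ps)"
    using assms unfolding proves_def by blast
  then have "derivation T (All A # A # ps)"
    by auto
  then show ?thesis unfolding proves_def by blast
qed

text \<open>The list induction establishes \<open>P\<close> for all entries of a derivation at once,
  because the rules refer back to arbitrary earlier entries.\<close>

lemma proves_induct [consumes 1, case_names logical assumption mp gen]:
  assumes "T \<turnstile> A"
    and logical: "\<And>A. A \<in> logical_axioms \<Longrightarrow> P A"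
    and assumption: "\<And>A. A \<in> T \<Longrightarrow> P A"
    and mp: "\<And>A B. P (Imp A B) \<Longrightarrow> P A \<Longrightarrow> P B"
    and gen: "\<And>A. P A \<Longrightarrow> P (All A)"
  shows "P A"
proof -
  have "derivation T ps \<Longrightarrow> \<forall>A \<in> set ps. P A" for ps
  proof (induction ps)
    case (Cons A ps)
    then have "P A" if "B \<in> set ps" "Imp B A \<in> set ps" for B
      using that mp by auto
    then show ?case using Cons logical assumption gen by auto
  qed simp
  then show ?thesis
    using assms(1) unfolding proves_def by fastforce
qed

lemma proves_cut:
  assumes "S \<turnstile> A" "\<And>B. B \<in> S \<Longrightarrow> T \<turnstile> B"
  shows "T \<turnstile> A"
  using assms(1)
  by (induction rule: proves_induct) (auto intro: proves_logical_axiom proves_mp proves_gen assms(2))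

subsection \<open>Propositional reasoning\<close>

lemma valuation_simps [simp]:
  assumes "valuation v"
  shows "\<not> v Fls"
    "v (Imp A B) \<longleftrightarrow> (v A \<longrightarrow> v B)"
    "v (Neg A) \<longleftrightarrow> \<not> v A"
    "v (Conj A B) \<longleftrightarrow> v A \<and> v B"
    "v (Disj A B) \<longleftrightarrow> v A \<or> v B"
    "v (Iff A B) \<longleftrightarrow> (v A \<longleftrightarrow> v B)"
    "v (BEx t A) \<longleftrightarrow> \<not> v (BAll t (Neg A))"
  using assms by (auto simp: valuation_def Neg_def Conj_def Disj_def Iff_def BEx_def)

text \<open>Closure under the propositional fragment of the calculus. Generalization is left out, so
  the deduction theorem holds without conditions on free variables.\<close>

definition prop_closed :: "fm set \<Rightarrow> bool" where
  "prop_closed S \<longleftrightarrow>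
     (\<forall>A B. Imp A (Imp B A) \<in> S) \<and>
     (\<forall>A B C. Imp (Imp A (Imp B C)) (Imp (Imp A B) (Imp A C)) \<in> S) \<and>
     (\<forall>A. Imp (Neg (Neg A)) A \<in> S) \<and>
     (\<forall>A B. Imp A B \<in> S \<longrightarrow> A \<in> S \<longrightarrow> B \<in> S)"

lemma prop_closed_mp: "prop_closed S \<Longrightarrow> Imp A B \<in> S \<Longrightarrow> A \<in> S \<Longrightarrow> B \<in> S"
  unfolding prop_closed_def by blast

lemma prop_closed_weaken: "prop_closed S \<Longrightarrow> B \<in> S \<Longrightarrow> Imp A B \<in> S"
  unfolding prop_closed_def by blast

text \<open>The deduction theorem in terms of sets: \<open>{B. Imp A B \<in> S}\<close> plays the
  part of \<open>S\<close> with \<open>A\<close> adjoined.\<close>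

lemma prop_closed_deduction:
  assumes S: "prop_closed S"
  shows "prop_closed {B. Imp A B \<in> S}" "A \<in> {B. Imp A B \<in> S}" "S \<subseteq> {B. Imp A B \<in> S}"
proof -
  have "Imp (Imp A (Imp (Imp A A) A)) (Imp (Imp A (Imp A A)) (Imp A A)) \<in> S"
    "Imp A (Imp (Imp A A) A) \<in> S" "Imp A (Imp A A) \<in> S"
    using S unfolding prop_closed_def by blast+
  then show "A \<in> {B. Imp A B \<in> S}"
    using prop_closed_mp[OF S] by blast
  show "S \<subseteq> {B. Imp A B \<in> S}"
    using prop_closed_weaken[OF S] by blast
  have "Imp A C \<in> S" if "Imp A (Imp B C) \<in> S" "Imp A B \<in> S" for B C
  proof -
    have "Imp (Imp A (Imp B C)) (Imp (Imp A B) (Imp A C)) \<in> S"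
      using S unfolding prop_closed_def by blast
    then show ?thesis
      using that prop_closed_mp[OF S] by blast
  qed
  then show "prop_closed {B. Imp A B \<in> S}"
    using S prop_closed_weaken[OF S] unfolding prop_closed_def[of "{B. Imp A B \<in> S}"]
    unfolding mem_Collect_eq
    by (metis (no_types, lifting) prop_closed_def)
qed

lemma prop_closed_by_contradiction:
  assumes S: "prop_closed S" and "Imp (Neg A) Fls \<in> S"
  shows "A \<in> S"
proof -
  have "Imp (Neg (Neg A)) A \<in> S"
    using S unfolding prop_closed_def by blast
  then show ?thesis
    using assms(2) prop_closed_mp[OF S] unfolding Neg_def by blast
qed

lemma prop_closed_ex_falso:
  assumes "prop_closed S" "Fls \<in> S"
  shows "A \<in> S"
  using prop_closed_by_contradiction prop_closed_weaken assms by blast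

text \<open>Under \<open>Neg A\<close> the first premise refutes \<open>C\<close>; then the second
  yields \<open>A\<close>, a contradiction.\<close>

lemma prop_closed_cases:
  assumes S: "prop_closed S" and C: "Imp C A \<in> S" and not_C: "Imp (Neg C) A \<in> S"
  shows "A \<in> S"
proof (rule prop_closed_by_contradiction[OF S])
  \<comment> \<open>\<open>?S\<close> adjoins \<open>Neg A\<close> to \<open>S\<close>, and
    \<open>?S'\<close> adjoins \<open>C\<close> on top of it.\<close>
  let ?S = "{B. Imp (Neg A) B \<in> S}" and ?S' = "{B. Imp (Neg A) (Imp C B) \<in> S}"
  note S1 = prop_closed_deduction[OF S, of "Neg A"]
  note S2 = prop_closed_deduction[OF S1(1), of C, unfolded mem_Collect_eq]
  have "Imp C A \<in> ?S'" "Imp A Fls \<in> ?S'" "C \<in> ?S'"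
    using C S1 S2 unfolding Neg_def by blast+
  then have "Fls \<in> ?S'"
    using prop_closed_mp[OF S2(1)] by blast
  then have "Neg C \<in> ?S"
    by (simp add: Neg_def)
  moreover have "Imp (Neg C) A \<in> ?S" "Imp A Fls \<in> ?S"
    using not_C S1 unfolding Neg_def by blast+
  ultimately have "Fls \<in> ?S"
    using prop_closed_mp[OF S1(1)] by blast
  then show "Imp (Neg A) Fls \<in> S" by simp
qed

text \<open>Adjoining a formula outside \<open>S\<close> must make \<open>A\<close> derivable. If
  neither \<open>C\<close> nor \<open>Neg C\<close> were in \<open>S\<close>, a case distinction
  would put \<open>A\<close> into \<open>S\<close>.\<close>

lemma maximal_prop_closed:
  assumes S: "prop_closed S" "A \<notin> S"
    and maximal: "\<And>S'. prop_closed S' \<Longrightarrow> A \<notin> S' \<Longrightarrow> S \<subseteq> S' \<Longrightarrow> S' = S"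
  shows "valuation (\<lambda>B. B \<in> S)"
proof -
  have *: "Imp C A \<in> S" if "C \<notin> S" for C
    using prop_closed_deduction[OF S(1), of C] maximal[of "{B. Imp C B \<in> S}"] that by blast
  have "Imp C B \<in> S" if "C \<notin> S" for B C
  proof -
    have "Neg C \<in> S"
      using *[of "Neg C"] *[OF that] prop_closed_cases[OF S(1)] S(2) by blast
    then have "Fls \<in> {B. Imp C B \<in> S}"
      by (simp add: Neg_def)
    then have "B \<in> {B. Imp C B \<in> S}"
      using prop_closed_ex_falso[OF prop_closed_deduction(1)[OF S(1)]] by blast
    then show ?thesis by simp
  qed
  then show ?thesis
    unfolding valuation_def
    using prop_closed_ex_falso[OF S(1)] prop_closed_weaken[OF S(1)] prop_closed_mp[OF S(1)] S(2)
    by blast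
qed

text \<open>Lindenbaum's construction; the maximal set contains all theorems of \<open>T\<close>, so in an application
  of the rule any theorems may be used as premises.\<close>

lemma proves_by_valuation:
  assumes "\<And>v. valuation v \<Longrightarrow> (\<And>B. T \<turnstile> B \<Longrightarrow> v B) \<Longrightarrow> v A"
  shows "T \<turnstile> A"
proof (rule ccontr)
  assume A: "\<not> T \<turnstile> A"
  let ?F = "{S. prop_closed S \<and> {B. T \<turnstile> B} \<subseteq> S \<and> A \<notin> S}"
  have "prop_closed {B. T \<turnstile> B}"
    unfolding prop_closed_def
    by (auto intro: proves_logical_axiom logical_axioms.intros proves_mp)
  then have "?F \<noteq> {}" using A by blast
  \<comment> \<open>For Zorn's lemma, the critical point is closure of the union under modus ponens:
    members containing the two premises are comparable, so the larger one contains both.\<close>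
  moreover have "\<Union>\<C> \<in> ?F" if "\<C> \<noteq> {}" "subset.chain ?F \<C>" for \<C>
  proof -
    have \<C>: "\<And>S. S \<in> \<C> \<Longrightarrow> S \<in> ?F" and chain: "\<And>S S'. S \<in> \<C> \<Longrightarrow> S' \<in> \<C> \<Longrightarrow> S \<subseteq> S' \<or> S' \<subseteq> S"
      using that(2) unfolding subset_chain_def by blast+
    have "B \<in> \<Union>\<C>" if CB: "Imp C B \<in> \<Union>\<C>" "C \<in> \<Union>\<C>" for B C
    proof -
      obtain S S' where "S \<in> \<C>" "Imp C B \<in> S" "S' \<in> \<C>" "C \<in> S'"
        using CB by blast
      moreover from this have "S \<subseteq> S' \<or> S' \<subseteq> S"
        using chain by blast
      ultimately obtain S where "S \<in> \<C>" "Imp C B \<in> S" "C \<in> S"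
        by blast
      then show ?thesis using \<C> prop_closed_mp by blast
    qed
    moreover obtain S where "S \<in> \<C>" using \<open>\<C> \<noteq> {}\<close> by blast
    ultimately show ?thesis
      using \<C> unfolding prop_closed_def by blast
  qed
  ultimately obtain S where "S \<in> ?F" and "\<forall>S' \<in> ?F. S \<subseteq> S' \<longrightarrow> S' = S"
    using subset_Zorn_nonempty[of ?F] by blast
  then have "valuation (\<lambda>B. B \<in> S)"
    by (intro maximal_prop_closed[of S A]) blast+
  then show False
    using assms[of "\<lambda>B. B \<in> S"] \<open>S \<in> ?F\<close> by blast
qed

lemma proves_tautology:
  assumes "\<And>v. valuation v \<Longrightarrow> v A"
  shows "T \<turnstile> A"
  using assms by (rule proves_by_valuation)

lemma proves_consequence:
  assumes "T \<turnstile> A" "\<And>v. valuation v \<Longrightarrow> v A \<Longrightarrow> v B"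
  shows "T \<turnstile> B"
  by (rule proves_by_valuation) (simp add: assms)

lemma proves_consequence2:
  assumes "T \<turnstile> A" "T \<turnstile> B" "\<And>v. valuation v \<Longrightarrow> v A \<Longrightarrow> v B \<Longrightarrow> v C"
  shows "T \<turnstile> C"
  by (rule proves_by_valuation) (simp add: assms)

lemma proves_consequence3:
  assumes "T \<turnstile> A" "T \<turnstile> B" "T \<turnstile> C" "\<And>v. valuation v \<Longrightarrow> v A \<Longrightarrow> v B \<Longrightarrow> v C \<Longrightarrow> v D"
  shows "T \<turnstile> D"
  by (rule proves_by_valuation) (simp add: assms)

subsection \<open>Quantifiers and equality\<close>

text \<open>Quantifiers are removed from the outside. Of \<open>Suc n\<close> quantifiers the
  outermost binds variable \<open>n\<close> of the matrix, and its term is lifted \<open>n\<close>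
  times as it passes under the others.\<close>

lemma proves_funpow_All_subst:
  "T \<turnstile> (All ^^ n) A \<Longrightarrow> T \<turnstile> subst (\<lambda>i. if i < n then \<sigma> i else Var (i - n)) A"
proof (induction n arbitrary: A)
  case (Suc n)
  let ?\<tau> = "\<lambda>i. if i < n then Var i else if i = n then L n (\<sigma> n) else Var (i - 1)"
  have *: "subst \<rho> ((All ^^ k) A) = (All ^^ k) (subst ((up ^^ k) \<rho>) A)" for k \<rho>
    by (induction k arbitrary: \<rho>) (simp_all add: funpow_swap1[of up])
  have "(up ^^ k) (case_nat t Var) i =
      (if i < k then Var i else if i = k then L k t else Var (i - 1))" for k t i
  proof (induction k arbitrary: i)
    case 0
    then show ?case by (simp split: nat.split)
  next
    case (Suc k)
    then show ?case by (cases i) auto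
  qed
  then have "(up ^^ n) (case_nat (\<sigma> n) Var) = ?\<tau>" by blast
  moreover have "T \<turnstile> inst [\<sigma> n] ((All ^^ n) A)"
    using Suc.prems by (auto intro: proves_mp proves_logical_axiom logical_axioms.intros)
  ultimately have "T \<turnstile> (All ^^ n) (subst ?\<tau> A)"
    by (simp only: inst_single *)
  from Suc.IH[OF this]
  have "T \<turnstile> subst (\<lambda>i. if i < n then \<sigma> i else Var (i - n)) (subst ?\<tau> A)" .
  also have "subst (\<lambda>i. if i < n then \<sigma> i else Var (i - n)) (subst ?\<tau> A) =
      subst (\<lambda>i. if i < Suc n then \<sigma> i else Var (i - Suc n)) A"
    unfolding subst_subst
  proof (rule subst_cong, rule ballI)
    fix i
    \<comment> \<open>The later instantiation undoes the lifting, so the terms inserted for the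
      other variables do not affect \<open>\<sigma> n\<close>.\<close>
    have "subst_tm (\<lambda>i. if i < n then \<sigma> i else Var (i - n)) (L n (\<sigma> n)) = \<sigma> n"
      by (simp add: L_eq_subst_tm subst_tm_subst_tm)
    then show "subst_tm (\<lambda>i. if i < n then \<sigma> i else Var (i - n)) (?\<tau> i) =
        (if i < Suc n then \<sigma> i else Var (i - Suc n))"
      by (cases "i = n") auto
  qed
  finally show ?case .
qed simp

text \<open>Generalize over all free variables, then instantiate them simultaneously; no free
  variable is left to be lowered.\<close>

lemma proves_subst:
  assumes "T \<turnstile> A"
  shows "T \<turnstile> subst \<sigma> A"
proof -
  obtain n where n: "fv A \<subseteq> {..<n}"
    using finite_fv[of A] unfolding finite_nat_set_iff_bounded by blast
  have "T \<turnstile> (All ^^ n) A"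
    using assms by (induction n) (simp_all add: proves_gen)
  then have "T \<turnstile> subst (\<lambda>i. if i < n then \<sigma> i else Var (i - n)) A"
    by (rule proves_funpow_All_subst)
  also have "subst (\<lambda>i. if i < n then \<sigma> i else Var (i - n)) A = subst \<sigma> A"
    using n by (intro subst_cong) auto
  finally show ?thesis .
qed

lemma proves_All_elim: "T \<turnstile> Imp (All A) (subst (case_nat t Var) A)"
  by (metis inst_single proves_logical_axiom logical_axioms.intros(4))

lemma proves_BAll_elim:
  "T \<turnstile> Imp (BAll s A) (Imp (Le t s) (subst (case_nat t Var) A))"
  using proves_All_elim[of T "Imp (Le (Var 0) (lift_tm s)) A" t] by (simp add: BAll_def)

text \<open>Generalization under a hypothesis: the shifted \<open>H\<close> does not contain the
  generalized variable, and the axiom on vacuous quantifiers provides its generalization.\<close>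

lemma proves_All_mono:
  assumes "T \<turnstile> Imp (subst (\<lambda>i. Var (Suc i)) H) (Imp A B)"
  shows "T \<turnstile> Imp H (Imp (All A) (All B))"
proof (rule proves_by_valuation)
  fix v assume v: "valuation v" "\<And>B. T \<turnstile> B \<Longrightarrow> v B"
  let ?H = "subst (\<lambda>i. Var (Suc i)) H"
  have "T \<turnstile> All (Imp ?H (Imp A B))"
    using assms by (rule proves_gen)
  moreover have "T \<turnstile> Imp H (All ?H)"
    by (metis lift_def proves_logical_axiom logical_axioms.intros(6))
  moreover have "T \<turnstile> Imp (All (Imp X Y)) (Imp (All X) (All Y))" for X Y
    by (intro proves_logical_axiom logical_axioms.intros)
  ultimately show "v (Imp H (Imp (All A) (All B)))"
    using v by (metis valuation_simps(2))
qed

lemma proves_All_intro: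
  assumes "T \<turnstile> Imp (subst (\<lambda>i. Var (Suc i)) H) A"
  shows "T \<turnstile> Imp H (All A)"
proof (rule proves_by_valuation)
  fix v assume v: "valuation v" "\<And>B. T \<turnstile> B \<Longrightarrow> v B"
  \<comment> \<open>\<open>Imp Fls Fls\<close> serves as a trivially provable antecedent, which
    reduces the claim to monotonicity.\<close>
  have "T \<turnstile> Imp (subst (\<lambda>i. Var (Suc i)) H) (Imp (Imp Fls Fls) A)"
    using assms by (rule proves_consequence) simp
  then have "T \<turnstile> Imp H (Imp (All (Imp Fls Fls)) (All A))"
    by (rule proves_All_mono)
  moreover have "T \<turnstile> All (Imp Fls Fls)"
    by (intro proves_gen proves_by_valuation) simp
  ultimately show "v (Imp H (All A))"
    using v(1) v(2)[of "All (Imp Fls Fls)"] v(2)[of "Imp H (Imp (All (Imp Fls Fls)) (All A))"] by simp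
qed

lemma proves_BAll_intro:
  assumes "T \<turnstile> Imp (subst (\<lambda>i. Var (Suc i)) H) A"
  shows "T \<turnstile> Imp H (BAll t A)"
  unfolding BAll_def
  using assms by (intro proves_All_intro) (erule proves_consequence, simp)

lemma proves_BAll_mono:
  assumes "T \<turnstile> Imp (subst (\<lambda>i. Var (Suc i)) H) (Imp A B)"
  shows "T \<turnstile> Imp H (Imp (BAll t A) (BAll t B))"
  unfolding BAll_def
  using assms by (intro proves_All_mono) (erule proves_consequence, simp)

lemma proves_BEx_mono:
  assumes "T \<turnstile> Imp (subst (\<lambda>i. Var (Suc i)) H) (Imp A B)"
  shows "T \<turnstile> Imp H (Imp (BEx t A) (BEx t B))"
proof -
  have "T \<turnstile> Imp (subst (\<lambda>i. Var (Suc i)) H) (Imp (Neg B) (Neg A))"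
    using assms by (rule proves_consequence) auto
  from proves_BAll_mono[OF this, of t] show ?thesis
    by (rule proves_consequence) auto
qed

lemma proves_BEx_intro:
  "T \<turnstile> Imp (Le t s) (Imp (subst (case_nat t Var) A) (BEx s A))"
proof (rule proves_by_valuation)
  fix v assume v: "valuation v" "\<And>B. T \<turnstile> B \<Longrightarrow> v B"
  show "v (Imp (Le t s) (Imp (subst (case_nat t Var) A) (BEx s A)))"
    using v(1) v(2)[OF proves_BAll_elim[of T s "Neg A" t]] by auto
qed

lemma proves_Eq_refl: "T \<turnstile> Eq t t"
  by (intro proves_logical_axiom logical_axioms.intros)

text \<open>The equality axiom speaks about variables 0 and 1 only; closure under substitution
  extends it to terms. In \<open>A\<close>, variable 0 is the hole and \<open>\<tau>\<close> fills
  the rest.\<close>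

lemma proves_Eq_subst:
  "T \<turnstile> Imp (Eq s t) (Imp (subst (case_nat s \<tau>) A) (subst (case_nat t \<tau>) A))"
proof -
  \<comment> \<open>Shifting the other variables by one keeps variable 1 out of \<open>?A\<close>,
    so it can stand for the right side \<open>t\<close>.\<close>
  let ?A = "subst (case_nat (Var 0) (\<lambda>i. Var (Suc (Suc i)))) A"
  let ?\<sigma> = "case_nat s (case_nat t \<tau>)"
  have "T \<turnstile> Imp (Eq (Var 0) (Var 1)) (Imp ?A (rename_fm ?A))"
    by (intro proves_logical_axiom logical_axioms.intros)
  from proves_subst[OF this, of ?\<sigma>]
  have "T \<turnstile> Imp (Eq s t) (Imp (subst ?\<sigma> ?A) (subst ?\<sigma> (rename_fm ?A)))"
    by simp
  moreover have "subst ?\<sigma> ?A = subst (case_nat s \<tau>) A"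
    unfolding subst_subst by (rule subst_cong) (simp split: nat.split)
  moreover have "subst ?\<sigma> (rename_fm ?A) = subst (case_nat t \<tau>) A"
    unfolding subst_subst rename_fm_def by (rule subst_cong) (simp split: nat.split)
  ultimately show ?thesis by simp
qed

lemma proves_Eq_rewrite:
  assumes "T \<turnstile> Eq s t" "T \<turnstile> subst (case_nat s \<tau>) A"
  shows "T \<turnstile> subst (case_nat t \<tau>) A"
  using assms proves_Eq_subst proves_mp by blast

lemma proves_Eq_sym:
  assumes "T \<turnstile> Eq s t"
  shows "T \<turnstile> Eq t s"
  using proves_Eq_rewrite[OF assms, of Var "Eq (Var 0) (lift_tm s)"] by (simp add: proves_Eq_refl)

lemma proves_Eq_trans:
  assumes "T \<turnstile> Eq s t" "T \<turnstile> Eq t u"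
  shows "T \<turnstile> Eq s u"
  using proves_Eq_rewrite[OF assms(2), of Var "Eq (lift_tm s) (Var 0)"] assms(1) by simp

lemma proves_Eq_cong:
  assumes "T \<turnstile> Eq s t"
  shows "T \<turnstile> Eq (subst_tm (case_nat s Var) u) (subst_tm (case_nat t Var) u)"
  \<comment> \<open>Rewriting starts from reflexivity; the lifted left side contains no hole and
    stays fixed.\<close>
  using proves_Eq_rewrite[OF assms, of Var "Eq (lift_tm (subst_tm (case_nat s Var) u)) u"]
  by (simp add: proves_Eq_refl)

section \<open>Arithmetic in EA\<close>

lemma EA_subset_PA: "EA \<subseteq> PA"
  unfolding EA_def PA_def by blast

lemma EA_basic_axiom: "A \<in> set basic_axioms \<Longrightarrow> EA \<turnstile> A"
  by (rule proves_assumption) (simp add: EA_def)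

lemma EA_axioms:
  "EA \<turnstile> Neg (Eq (Succ s) Zero)"
  "EA \<turnstile> Imp (Eq (Succ s) (Succ t)) (Eq s t)"
  "EA \<turnstile> Eq (Plus s Zero) s"
  "EA \<turnstile> Eq (Plus s (Succ t)) (Succ (Plus s t))"
  "EA \<turnstile> Eq (Times s Zero) Zero"
  "EA \<turnstile> Eq (Times s (Succ t)) (Plus (Times s t) s)"
  "EA \<turnstile> Eq (Exp2 Zero) (Succ Zero)"
  "EA \<turnstile> Eq (Exp2 (Succ s)) (Plus (Exp2 s) (Exp2 s))"
  "EA \<turnstile> Iff (Le s Zero) (Eq s Zero)"
  "EA \<turnstile> Iff (Le s (Succ t)) (Disj (Le s t) (Eq s (Succ t)))"
proof -
  \<comment> \<open>One substitution handles axioms with 0, 1 or 2 quantifiers: variable 0 becomes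
    \<open>s\<close>, variable 1 becomes \<open>t\<close>.\<close>
  have ax: "EA \<turnstile> subst (\<lambda>i. if i < n then case_nat s (\<lambda>_. t) i else Var (i - n)) A"
    if "(All ^^ n) A \<in> set basic_axioms" for n A
    using EA_basic_axiom[OF that] by (rule proves_funpow_All_subst)
  note basic = basic_axioms_def numeral_2_eq_2
  show "EA \<turnstile> Neg (Eq (Succ s) Zero)"
    using ax[of 1 "Neg (Eq (Succ (Var 0)) Zero)"] by (simp add: basic)
  show "EA \<turnstile> Imp (Eq (Succ s) (Succ t)) (Eq s t)"
    using ax[of 2 "Imp (Eq (Succ (Var 0)) (Succ (Var 1))) (Eq (Var 0) (Var 1))"] by (simp add: basic)
  show "EA \<turnstile> Eq (Plus s Zero) s"
    using ax[of 1 "Eq (Plus (Var 0) Zero) (Var 0)"] by (simp add: basic)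
  show "EA \<turnstile> Eq (Plus s (Succ t)) (Succ (Plus s t))"
    using ax[of 2 "Eq (Plus (Var 0) (Succ (Var 1))) (Succ (Plus (Var 0) (Var 1)))"] by (simp add: basic)
  show "EA \<turnstile> Eq (Times s Zero) Zero"
    using ax[of 1 "Eq (Times (Var 0) Zero) Zero"] by (simp add: basic)
  show "EA \<turnstile> Eq (Times s (Succ t)) (Plus (Times s t) s)"
    using ax[of 2 "Eq (Times (Var 0) (Succ (Var 1))) (Plus (Times (Var 0) (Var 1)) (Var 0))"]
    by (simp add: basic)
  show "EA \<turnstile> Eq (Exp2 Zero) (Succ Zero)"
    using ax[of 0 "Eq (Exp2 Zero) (Succ Zero)"] by (simp add: basic)
  show "EA \<turnstile> Eq (Exp2 (Succ s)) (Plus (Exp2 s) (Exp2 s))"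
    using ax[of 1 "Eq (Exp2 (Succ (Var 0))) (Plus (Exp2 (Var 0)) (Exp2 (Var 0)))"] by (simp add: basic)
  show "EA \<turnstile> Iff (Le s Zero) (Eq s Zero)"
    using ax[of 1 "Iff (Le (Var 0) Zero) (Eq (Var 0) Zero)"] by (simp add: basic)
  show "EA \<turnstile> Iff (Le s (Succ t)) (Disj (Le s t) (Eq s (Succ t)))"
    using ax[of 2 "Iff (Le (Var 0) (Succ (Var 1))) (Disj (Le (Var 0) (Var 1)) (Eq (Var 0) (Succ (Var 1))))"]
    by (simp add: basic)
qed

lemma EA_Eq_cong:
  assumes "EA \<turnstile> Eq s t"
  shows "EA \<turnstile> Eq (Succ s) (Succ t)" "EA \<turnstile> Eq (Plus s u) (Plus t u)" "EA \<turnstile> Eq (Plus u s) (Plus u t)"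
    "EA \<turnstile> Eq (Times s u) (Times t u)" "EA \<turnstile> Eq (Times u s) (Times u t)" "EA \<turnstile> Eq (Exp2 s) (Exp2 t)"
  using proves_Eq_cong[OF assms, of "Succ (Var 0)"]
    proves_Eq_cong[OF assms, of "Plus (Var 0) (lift_tm u)"] proves_Eq_cong[OF assms, of "Plus (lift_tm u) (Var 0)"]
    proves_Eq_cong[OF assms, of "Times (Var 0) (lift_tm u)"] proves_Eq_cong[OF assms, of "Times (lift_tm u) (Var 0)"]
    proves_Eq_cong[OF assms, of "Exp2 (Var 0)"]
  by simp_all

section \<open>Computation with numerals\<close>

lemma EA_Plus: "EA \<turnstile> Eq (Plus (nm m) (nm n)) (nm (m + n))"
proof (induction n)
  case 0
  then show ?case using EA_axioms(3) by simp
next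
  case (Suc n)
  then show ?case
    using proves_Eq_trans[OF EA_axioms(4) EA_Eq_cong(1)[OF Suc]] by simp
qed

lemma EA_Times: "EA \<turnstile> Eq (Times (nm m) (nm n)) (nm (m * n))"
proof (induction n)
  case 0
  then show ?case using EA_axioms(5) by simp
next
  case (Suc n)
  have "EA \<turnstile> Eq (Times (nm m) (nm (Suc n))) (nm (m * n + m))"
    using proves_Eq_trans[OF EA_axioms(6) proves_Eq_trans[OF EA_Eq_cong(2)[OF Suc] EA_Plus]] by simp
  then show ?case by (simp add: add.commute)
qed

lemma EA_Exp2: "EA \<turnstile> Eq (Exp2 (nm n)) (nm (2 ^ n))"
proof (induction n)
  case 0
  then show ?case using EA_axioms(7) by simp
next
  case (Suc n)
  have "EA \<turnstile> Eq (Plus (Exp2 (nm n)) (Exp2 (nm n))) (nm (2 ^ n + 2 ^ n))"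
    using proves_Eq_trans[OF EA_Eq_cong(2)[OF Suc] proves_Eq_trans[OF EA_Eq_cong(3)[OF Suc] EA_Plus]] .
  from proves_Eq_trans[OF EA_axioms(8) this] show ?case
    by (simp add: mult_2)
qed

text \<open>Once numerals replace the variables, the term is closed and the recursion equations
  evaluate it from the inside out.\<close>

lemma EA_val: "EA \<turnstile> Eq (subst_tm (\<lambda>i. nm (e i)) t) (nm (val e t))"
proof (induction t)
  case (Var i)
  then show ?case by (simp add: proves_Eq_refl)
next
  case Zero
  then show ?case by (simp add: proves_Eq_refl)
next
  case (Succ t)
  then show ?case by (simp add: EA_Eq_cong)
next
  case (Plus s t)
  then show ?case
    using proves_Eq_trans[OF EA_Eq_cong(2) proves_Eq_trans[OF EA_Eq_cong(3) EA_Plus]] by simp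
next
  case (Times s t)
  then show ?case
    using proves_Eq_trans[OF EA_Eq_cong(4) proves_Eq_trans[OF EA_Eq_cong(5) EA_Times]] by simp
next
  case (Exp2 t)
  then show ?case
    using proves_Eq_trans[OF EA_Eq_cong(6) EA_Exp2] by simp
qed

lemma EA_Neg_Eq: "m \<noteq> n \<Longrightarrow> EA \<turnstile> Neg (Eq (nm m) (nm n))"
proof (induction m arbitrary: n)
  case 0
  then obtain k where k: "n = Suc k" by (cases n) auto
  show ?case
  proof (rule proves_by_valuation)
    fix v assume v: "valuation v" "\<And>B. EA \<turnstile> B \<Longrightarrow> v B"
    \<comment> \<open>Symmetry of equality in this instance, as the axiom has the successor on the
      left.\<close>
    have "EA \<turnstile> Imp (Eq Zero (nm n)) (Imp (Eq Zero Zero) (Eq (nm n) Zero))"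
      using proves_Eq_subst[of EA Zero "nm n" Var "Eq (Var 0) Zero"] by simp
    from v(2)[OF this] v(2)[OF proves_Eq_refl] v(2)[OF EA_axioms(1)[of "nm k"]]
    show "v (Neg (Eq (nm 0) (nm n)))"
      using v(1) k by simp
  qed
next
  case (Suc m)
  show ?case
  proof (cases n)
    case 0
    then show ?thesis using EA_axioms(1) by simp
  next
    case (Suc k)
    then have "EA \<turnstile> Neg (Eq (nm m) (nm k))"
      using Suc.IH[of k] Suc.prems by simp
    then show ?thesis
      unfolding Suc by (rule proves_consequence2[OF _ EA_axioms(2)[of "nm m" "nm k"]]) simp
  qed
qed

text \<open>The induction is on the upper bound because the axioms on \<open>Le\<close> recurse on
  the right argument. Both outcomes are carried together since the step may need either.\<close>

lemma EA_Le: "if m \<le> n then EA \<turnstile> Le (nm m) (nm n) else EA \<turnstile> Neg (Le (nm m) (nm n))"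
proof (induction n)
  case 0
  show ?case
  proof (cases "m = 0")
    case True
    have "EA \<turnstile> Le (nm 0) (nm 0)"
      by (rule proves_consequence2[OF EA_axioms(9)[of Zero] proves_Eq_refl[of EA Zero]]) simp
    then show ?thesis
      using True by simp
  next
    case False
    have "EA \<turnstile> Neg (Le (nm m) (nm 0))"
      by (rule proves_consequence2[OF EA_axioms(9)[of "nm m"] EA_Neg_Eq[OF False]]) simp
    then show ?thesis
      using False by simp
  qed
next
  case (Suc n)
  note ax = EA_axioms(10)[of "nm m" "nm n"]
  consider "m \<le> n" | "m = Suc n" | "m > Suc n" by linarith
  then show ?case
  proof cases
    case 1
    then have "EA \<turnstile> Le (nm m) (nm n)"
      using Suc by simp
    then have "EA \<turnstile> Le (nm m) (nm (Suc n))"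
      by (rule proves_consequence2[OF _ ax]) simp
    then show ?thesis
      using 1 by simp
  next
    case 2
    then have "EA \<turnstile> Eq (nm m) (nm (Suc n))"
      by (simp add: proves_Eq_refl)
    then have "EA \<turnstile> Le (nm m) (nm (Suc n))"
      by (rule proves_consequence2[OF _ ax]) simp
    then show ?thesis
      using 2 by simp
  next
    case 3
    then have "EA \<turnstile> Neg (Le (nm m) (nm n))" "EA \<turnstile> Neg (Eq (nm m) (nm (Suc n)))"
      using Suc EA_Neg_Eq[of m "Suc n"] by auto
    then have "EA \<turnstile> Neg (Le (nm m) (nm (Suc n)))"
      by (rule proves_consequence3[OF _ _ ax]) simp
    then show ?thesis
      using 3 by simp
  qed
qed

section \<open>Bounded case distinctions and transitivity of the order\<close>

lemma proves_Imp_Eq_nm: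
  assumes "T \<turnstile> subst (case_nat (nm i) (\<lambda>i. Var (Suc i))) A"
  shows "T \<turnstile> Imp (Eq (Var 0) (nm i)) A"
proof (rule proves_by_valuation)
  fix v assume v: "valuation v" "\<And>B. T \<turnstile> B \<Longrightarrow> v B"
  \<comment> \<open>Leibniz's law is needed from \<open>nm i\<close> to \<open>Var 0\<close>, so the
    equation is reversed inside the implication first.\<close>
  have "T \<turnstile> Imp (Eq (Var 0) (nm i)) (Imp (Eq (Var 0) (Var 0)) (Eq (nm i) (Var 0)))"
    using proves_Eq_subst[of T "Var 0" "nm i" Var "Eq (Var 0) (Var 1)"] by simp
  from v(2)[OF this] v(2)[OF assms] v(2)[OF proves_Eq_refl[of T "Var 0"]]
    v(2)[OF proves_Eq_subst[of T "nm i" "Var 0" "\<lambda>i. Var (Suc i)" A]]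
  show "v (Imp (Eq (Var 0) (nm i)) A)"
    using v(1) by simp
qed

lemma EA_Le_nm_cases:
  assumes "\<And>i. i \<le> n \<Longrightarrow> EA \<turnstile> subst (case_nat (nm i) (\<lambda>i. Var (Suc i))) A"
  shows "EA \<turnstile> Imp (Le (Var 0) (nm n)) A"
  using assms
proof (induction n)
  case 0
  then have "EA \<turnstile> Imp (Eq (Var 0) (nm 0)) A"
    using proves_Imp_Eq_nm by blast
  then show ?case
    by (rule proves_consequence2[OF _ EA_axioms(9)[of "Var 0"]]) simp
next
  case (Suc n)
  then have "EA \<turnstile> Imp (Le (Var 0) (nm n)) A"
    by simp
  moreover have "EA \<turnstile> Imp (Eq (Var 0) (nm (Suc n))) A"
    by (rule proves_Imp_Eq_nm[OF Suc.prems]) simp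
  ultimately show ?case
    by (rule proves_consequence3[OF _ _ EA_axioms(10)[of "Var 0" "nm n"]]) simp
qed

text \<open>The term \<open>t\<close> may contain variables, so computation with numerals does not
  suffice: this is an induction on the bound inside EA.\<close>

lemma EA_Le_mono:
  assumes "k \<le> p"
  shows "EA \<turnstile> Imp (Le (nm p) t) (Le (nm k) t)"
proof -
  let ?A = "Imp (Le (nm p) (Var 0)) (Le (nm k) (Var 0))"
  have kp: "EA \<turnstile> Le (nm k) (nm p)"
    using EA_Le[of k p] assms by simp
  have zero: "EA \<turnstile> inst [Zero] ?A"
  proof (cases "p = 0")
    case True
    then have "k = p" using assms by simp
    then show ?thesis
      by (intro proves_tautology) (simp add: inst_single)
  next
    case False
    then have "EA \<turnstile> Neg (Le (nm p) (nm 0))"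
      using EA_Le[of p 0] by simp
    then show ?thesis
      by (rule proves_consequence) (simp add: inst_single)
  qed
  have step: "EA \<turnstile> Imp ?A (succ_fm ?A)"
  proof (rule proves_by_valuation)
    fix v assume v: "valuation v" "\<And>B. EA \<turnstile> B \<Longrightarrow> v B"
    \<comment> \<open>If \<open>p\<close> is below the successor, it is either below
      \<open>Var 0\<close>, where the induction hypothesis applies, or equal to the successor, where
      this rewriting of \<open>k \<le> p\<close> applies.\<close>
    have "EA \<turnstile> Imp (Eq (nm p) (Succ (Var 0))) (Imp (Le (nm k) (nm p)) (Le (nm k) (Succ (Var 0))))"
      using proves_Eq_subst[of EA "nm p" "Succ (Var 0)" Var "Le (nm k) (Var 0)"] by simp
    from v(2)[OF this] v(2)[OF kp] v(2)[OF EA_axioms(10)[of "nm p" "Var 0"]]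
      v(2)[OF EA_axioms(10)[of "nm k" "Var 0"]]
    show "v (Imp ?A (succ_fm ?A))"
      using v(1) by (auto simp: succ_fm_def)
  qed
  have "sentence (induction_fm ?A)"
    by (auto simp: sentence_def induction_fm_def inst_single succ_fm_def)
  moreover have "elementary ?A" by simp
  ultimately have "induction_fm ?A \<in> EA"
    \<comment> \<open>Variable 0 is the only variable of \<open>?A\<close>, so the induction formula
      is closed and a prefix of 0 quantifiers does.\<close>
    unfolding EA_def by (auto intro!: exI[of _ 0] exI[of _ ?A])
  then have "EA \<turnstile> Imp (inst [Zero] ?A) (Imp (All (Imp ?A (succ_fm ?A))) (All ?A))"
    unfolding induction_fm_def by (rule proves_assumption)
  then have "EA \<turnstile> All ?A"
    using zero step proves_gen proves_mp by blast
  then show ?thesis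
    using proves_mp[OF proves_All_elim[of EA ?A t]] by simp
qed

section \<open>Completeness for elementary sentences\<close>

text \<open>Truth and falsity are treated together, as implication exchanges them. The environment
  \<open>e\<close> records the values chosen for variables of bounded quantifiers.\<close>

lemma EA_elementary_complete:
  assumes "elementary A"
  shows "if sat e A then EA \<turnstile> subst (\<lambda>i. nm (e i)) A else EA \<turnstile> Neg (subst (\<lambda>i. nm (e i)) A)"
  using assms
proof (induction A arbitrary: e rule: elementary.induct)
  case (1 s t)
  let ?s = "subst_tm (\<lambda>i. nm (e i)) s" and ?t = "subst_tm (\<lambda>i. nm (e i)) t"
  show ?case
  proof (cases "val e s = val e t")
    case True
    then have "EA \<turnstile> Eq ?s ?t"
      using proves_Eq_trans[OF EA_val[of e s] proves_Eq_sym[OF EA_val[of e t, folded True]]] by simp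
    then show ?thesis using True by simp
  next
    case False
    have "EA \<turnstile> Neg (Eq (nm (val e s)) ?t)"
      using proves_Eq_rewrite[OF proves_Eq_sym[OF EA_val[of e t]], of Var "Neg (Eq (nm (val e s)) (Var 0))"]
        EA_Neg_Eq[OF False] by simp
    then have "EA \<turnstile> Neg (Eq ?s ?t)"
      using proves_Eq_rewrite[OF proves_Eq_sym[OF EA_val[of e s]], of Var "Neg (Eq (Var 0) (lift_tm ?t))"]
      by simp
    then show ?thesis using False by simp
  qed
next
  case (2 s t)
  let ?s = "subst_tm (\<lambda>i. nm (e i)) s" and ?t = "subst_tm (\<lambda>i. nm (e i)) t"
  \<comment> \<open>Replaces the two numerals by the terms they evaluate, for a general matrix so as
    to cover both \<open>Le\<close> and its negation.\<close>
  have *: "EA \<turnstile> subst (case_nat ?s (\<lambda>_. ?t)) A"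
    if "EA \<turnstile> subst (case_nat (nm (val e s)) (\<lambda>_. nm (val e t))) A" "fv A \<subseteq> {0, 1}" for A
  proof -
    let ?B = "subst (case_nat (nm (val e s)) (case_nat (Var 0) Var)) A"
    have B: "subst (case_nat u Var) ?B = subst (case_nat (nm (val e s)) (\<lambda>_. u)) A" for u
      unfolding subst_subst using that(2) by (intro subst_cong) auto
    have "EA \<turnstile> subst (case_nat (nm (val e s)) (\<lambda>_. ?t)) A"
      using proves_Eq_rewrite[OF proves_Eq_sym[OF EA_val[of e t]], of Var ?B] that(1) by (simp only: B)
    then show ?thesis
      using proves_Eq_rewrite[OF proves_Eq_sym[OF EA_val[of e s]]] by blast
  qed
  show ?case
    using *[of "Le (Var 0) (Var 1)"] *[of "Neg (Le (Var 0) (Var 1))"] EA_Le[of "val e s" "val e t"]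
    by (auto simp: Neg_def)
next
  case 3
  then show ?case
    by (auto intro!: proves_tautology)
next
  case (4 A B)
  let ?A = "subst (\<lambda>i. nm (e i)) A" and ?B = "subst (\<lambda>i. nm (e i)) B"
  have "EA \<turnstile> Imp ?A ?B" if "EA \<turnstile> Neg ?A \<or> EA \<turnstile> ?B"
    using that by (auto elim!: proves_consequence)
  moreover have "EA \<turnstile> Neg (Imp ?A ?B)" if "EA \<turnstile> ?A" "EA \<turnstile> Neg ?B"
    using that by (rule proves_consequence2) simp
  ultimately show ?case
    using 4(3,4)[of e] by (auto split: if_splits)
next
  case (5 A t)
  let ?\<sigma> = "\<lambda>i. nm (e i)"
  let ?t = "subst_tm ?\<sigma> t" and ?A = "subst (up ?\<sigma>) A" and ?n = "val e t"
  \<comment> \<open>Instantiating the quantified variable by \<open>nm i\<close> amounts to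
    extending the environment by \<open>i\<close>; \<open>\<rho>\<close> is arbitrary since all
    other variables have become numerals.\<close>
  have up: "(\<lambda>j. subst_tm (case_nat (nm i) \<rho>) (up ?\<sigma> j)) = (\<lambda>j. nm (case_nat i e j))" for i \<rho>
    by (simp add: fun_eq_iff up_def split: nat.split)
  show ?case
  proof (cases "sat e (BAll t A)")
    case True
    have "EA \<turnstile> subst (case_nat (nm i) (\<lambda>i. Var (Suc i))) ?A" if "i \<le> ?n" for i
      using 5(2)[of "case_nat i e"] True that by (simp add: subst_subst up)
    then have A: "EA \<turnstile> Imp (Le (Var 0) (nm ?n)) ?A"
      by (rule EA_Le_nm_cases)
    have "EA \<turnstile> Eq (lift_tm ?t) (nm ?n)"
      using proves_subst[OF EA_val[of e t], of "\<lambda>i. Var (Suc i)"] by (simp add: lift_tm_def)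
    \<comment> \<open>The bound is turned from its value back into the term. Variable 0 is the hole
      here, so the quantified variable is shifted to 1.\<close>
    from proves_Eq_rewrite[OF proves_Eq_sym[OF this], of Var "Imp (Le (Var 1) (Var 0)) (subst (\<lambda>i. Var (Suc i)) ?A)"] A
    have "EA \<turnstile> Imp (Le (Var 0) (lift_tm ?t)) ?A"
      by (simp add: subst_subst flip: lift_tm_def)
    then have "EA \<turnstile> BAll ?t ?A"
      unfolding BAll_def by (rule proves_gen)
    then show ?thesis
      using True by simp
  next
    case False
    then obtain i where i: "i \<le> ?n" "\<not> sat (case_nat i e) A"
      by auto
    have "EA \<turnstile> Le (nm i) (nm ?n)"
      using EA_Le[of i ?n] i by simp
    from proves_Eq_rewrite[OF proves_Eq_sym[OF EA_val[of e t]], of Var "Le (nm i) (Var 0)"] this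
    have "EA \<turnstile> Le (nm i) ?t"
      by simp
    moreover have "EA \<turnstile> Neg (subst (case_nat (nm i) Var) ?A)"
      using 5(2)[of "case_nat i e"] i(2) by (simp add: subst_subst up)
    ultimately have "EA \<turnstile> Neg (BAll ?t ?A)"
      by (rule proves_consequence3[OF _ _ proves_BAll_elim[of EA ?t ?A "nm i"]]) simp
    then show ?thesis
      using False by (simp del: sat_connectives)
  qed
qed

section \<open>The arithmetized notions under substitution\<close>

lemma subst_tm_codes [simp]:
  "subst_tm \<sigma> (Tup s t) = Tup (subst_tm \<sigma> s) (subst_tm \<sigma> t)"
  "subst_tm \<sigma> (Code2 j s t) = Code2 j (subst_tm \<sigma> s) (subst_tm \<sigma> t)"
  "subst_tm \<sigma> (Code1 n j s) = Code1 n j (subst_tm \<sigma> s)"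
  by (simp_all add: Code2_def Code1_def Tup_def)

lemma quote_closed [simp]:
  "subst_tm \<sigma> \<ulcorner>A\<urcorner> = \<ulcorner>A\<urcorner>" "lift_tm \<ulcorner>A\<urcorner> = \<ulcorner>A\<urcorner>"
  "subst_tm \<sigma> \<ulcorner>t\<urcorner>\<^sub>t = \<ulcorner>t\<urcorner>\<^sub>t" "lift_tm \<ulcorner>t\<urcorner>\<^sub>t = \<ulcorner>t\<urcorner>\<^sub>t"
  by (simp_all add: quote_fm_def quote_tm_def)

lemma subst_Mem [simp]:
  "subst \<sigma> (Is_Cons u s t) = Is_Cons (subst_tm \<sigma> u) (subst_tm \<sigma> s) (subst_tm \<sigma> t)"
  "subst \<sigma> (Mem s t) = Mem (subst_tm \<sigma> s) (subst_tm \<sigma> t)"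
  by (simp_all add: Is_Cons_def Mem_def numeral_eq_Suc)

text \<open>\<open>V\<close> is a function of the metalanguage, so the effect of
  \<open>\<sigma>\<close> on it is assumed, at the one instance that occurs, under four
  binders.\<close>

lemma subst_Tm_map:
  assumes "subst (up (up (up (up \<sigma>)))) (V (Var 0) (Var (Suc 0))) = W (Var 0) (Var (Suc 0))"
  shows "subst \<sigma> (Tm_map V a b) = Tm_map W (subst_tm \<sigma> a) (subst_tm \<sigma> b)"
  using assms by (simp add: Tm_map_def eval_nat_numeral)

lemma subst_Shift [simp]:
  "subst \<sigma> (Shift k a b) = Shift (subst_tm \<sigma> k) (subst_tm \<sigma> a) (subst_tm \<sigma> b)"
  unfolding Shift_def by (rule subst_Tm_map) (simp add: eval_nat_numeral)

lemma subst_Subst_tm [simp]: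
  "subst \<sigma> (Subst_tm u m k a b) =
     Subst_tm (subst_tm \<sigma> u) m (subst_tm \<sigma> k) (subst_tm \<sigma> a) (subst_tm \<sigma> b)"
  unfolding Subst_tm_def by (rule subst_Tm_map) (simp add: eval_nat_numeral)

lemma subst_Subst [simp]:
  "subst \<sigma> (Subst u m a b) = Subst (subst_tm \<sigma> u) m (subst_tm \<sigma> a) (subst_tm \<sigma> b)"
  by (simp add: Subst_def eval_nat_numeral)

lemma subst_Sent [simp]: "subst \<sigma> (Sent a) = Sent (subst_tm \<sigma> a)"
  by (simp add: Sent_def)

lemma subst_Logical_axiom [simp]: "subst \<sigma> (Logical_axiom x) = Logical_axiom (subst_tm \<sigma> x)"
  by (simp add: Logical_axiom_def Let_def eval_nat_numeral)

lemma subst_List_mem [simp]: "subst \<sigma> (List_mem b q) = List_mem (subst_tm \<sigma> b) (subst_tm \<sigma> q)"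
  by (simp add: List_mem_def eval_nat_numeral)

lemma subst_Justified [simp]:
  "subst \<sigma> (Justified F x q) = Justified (subst \<sigma> F) (subst_tm \<sigma> x) (subst_tm \<sigma> q)"
  by (simp add: Justified_def)

lemma subst_Proof:
  assumes "subst (up (up (up (up \<sigma>)))) (X (Var (Suc 0))) = Y (Var (Suc 0))"
  shows "subst \<sigma> (Proof X p y) = Proof Y (subst_tm \<sigma> p) (subst_tm \<sigma> y)"
  using assms by (simp add: Proof_def Derivation_def eval_nat_numeral)

lemma subst_inst:
  assumes "fv \<alpha> \<subseteq> {0}"
  shows "subst \<sigma> (inst [t] \<alpha>) = inst [subst_tm \<sigma> t] \<alpha>"
  unfolding inst_single subst_subst using assms by (intro subst_cong) auto

lemma subst_Prf:
  assumes "fv \<alpha> \<subseteq> {0}"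
  shows "subst \<sigma> (Prf \<alpha> p y) = Prf \<alpha> (subst_tm \<sigma> p) (subst_tm \<sigma> y)"
  unfolding Prf_def by (rule subst_Proof) (simp add: subst_inst[OF assms])

lemma subst_Box:
  assumes "fv \<alpha> \<subseteq> {0}"
  shows "subst \<sigma> (Box \<alpha> x y) = Box \<alpha> (subst_tm \<sigma> x) (subst_tm \<sigma> y)"
  by (simp add: Box_def subst_Prf[OF assms])

section \<open>Proofs within EA\<close>

text \<open>Closedness is stated as invariance under substitution, which the lemmas above verify by
  rewriting.\<close>

lemma EA_true_elementary:
  assumes "elementary A" "\<And>\<sigma>. subst \<sigma> A = A" "holds A"
  shows "EA \<turnstile> A"
  using EA_elementary_complete[OF assms(1), of "\<lambda>_. 0"] assms(2,3) by (simp add: holds_def)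

text \<open>Since \<open>T\<close> decides every elementary sentence correctly, its consistency forces a binumeration
  in \<open>T\<close> to be correct in the standard model.\<close>

lemma extension_binumeration:
  assumes \<alpha>: "elementary \<alpha>" "fv \<alpha> \<subseteq> {0}" "binumerates T \<alpha> X"
    and T: "\<not> T \<turnstile> Fls" "\<forall>A \<in> PA. T \<turnstile> A"
  shows "extension \<alpha> = X"
proof -
  have EA: "T \<turnstile> A" if "EA \<turnstile> A" for A
    using proves_cut[OF that] T(2) EA_subset_PA by blast
  have "A \<in> X \<longleftrightarrow> holds (inst [\<ulcorner>A\<urcorner>] \<alpha>)" for A
  proof -
    let ?A = "inst [\<ulcorner>A\<urcorner>] \<alpha>"
    have closed: "subst \<sigma> ?A = ?A" for \<sigma>
      by (simp add: subst_inst[OF \<alpha>(2)])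
    have "EA \<turnstile> ?A" if "holds ?A"
      using EA_true_elementary[OF _ closed that] \<alpha>(1) by simp
    moreover have "EA \<turnstile> Neg ?A" if "\<not> holds ?A"
      using EA_true_elementary[of "Neg ?A"] closed that \<alpha>(1) by (simp add: holds_def)
    moreover have "\<not> (T \<turnstile> ?A \<and> T \<turnstile> Neg ?A)"
      using T(1) proves_mp unfolding Neg_def by blast
    ultimately show ?thesis
      using EA \<alpha>(3) unfolding binumerates_def by blast
  qed
  then show ?thesis
    unfolding extension_def by blast
qed

lemma EA_Sent:
  assumes "sentence A"
  shows "EA \<turnstile> Sent \<ulcorner>A\<urcorner>"
  by (rule EA_true_elementary) (simp_all add: holds_def sat_Sent[where A = A] assms)

text \<open>The numeral of the actual proof is the witness: that it codes a proof is a true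
  elementary sentence, and the antecedent puts it below \<open>x\<close>.\<close>

lemma EA_Box:
  assumes \<alpha>: "elementary \<alpha>" "fv \<alpha> \<subseteq> {0}" and p: "codes_proof (extension \<alpha>) p A"
  shows "EA \<turnstile> Imp (Le (nm p) x) (Box \<alpha> x \<ulcorner>A\<urcorner>)"
proof -
  let ?P = "Prf \<alpha> (Var 0) (L 1 \<ulcorner>A\<urcorner>)"
  have "EA \<turnstile> Prf \<alpha> (nm p) \<ulcorner>A\<urcorner>"
    by (rule EA_true_elementary)
      (simp_all add: \<alpha>(1) subst_Prf[OF \<alpha>(2)] holds_def sat_Prf[OF \<alpha>(2), where A = A] p)
  then have "EA \<turnstile> subst (case_nat (nm p) Var) ?P"
    by (simp add: subst_Prf[OF \<alpha>(2)])
  then show ?thesis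
    unfolding Box_def by (rule proves_consequence2[OF _ proves_BEx_intro[of EA "nm p" x ?P]]) simp
qed

section \<open>Arithmetized valuations\<close>

lemma EA_Imp_code: "EA \<turnstile> Eq (Imp_code \<ulcorner>A\<urcorner> \<ulcorner>B\<urcorner>) \<ulcorner>Imp A B\<urcorner>"
  using EA_val[of "\<lambda>_. 0" "Imp_code \<ulcorner>A\<urcorner> \<ulcorner>B\<urcorner>"] by (simp add: quote_fm_def[of "Imp A B"])

lemma EA_Valuation_Fls: "EA \<turnstile> Imp (Valuation v x) (Neg (Mem \<ulcorner>Fls\<urcorner> v))"
  by (rule proves_tautology) (simp add: Valuation_def)

text \<open>Both quantifiers of the clause for implications are instantiated by quotations; all
  three codes are at most \<open>p\<close>, hence at most \<open>x\<close>.\<close>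

lemma EA_Valuation_Imp:
  assumes p: "gn (Imp A B) \<le> p"
  shows "EA \<turnstile> Imp (Valuation v x) (Imp (Le (nm p) x)
    (Iff (Mem \<ulcorner>Imp A B\<urcorner> v) (Imp (Mem \<ulcorner>A\<urcorner> v) (Mem \<ulcorner>B\<urcorner> v))))"
proof (rule proves_by_valuation)
  fix w assume w: "valuation w" "\<And>B. EA \<turnstile> B \<Longrightarrow> w B"
  \<comment> \<open>The code of the implication is a separate argument, so that the equality axiom
    can replace the pairing term by the numeral.\<close>
  define body where "body y a b v x = Imp (Le y x) (Iff (Mem y v) (Imp (Mem a v) (Mem b v)))" for y a b v x
  let ?c = "Imp_code \<ulcorner>A\<urcorner> \<ulcorner>B\<urcorner>"
  have subst_body: "subst \<sigma> (body y a b v x) =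
    body (subst_tm \<sigma> y) (subst_tm \<sigma> a) (subst_tm \<sigma> b) (subst_tm \<sigma> v) (subst_tm \<sigma> x)" for \<sigma> y a b v x
    by (simp add: body_def)
  have Valuation: "Valuation v x = Conj (Neg (Mem \<ulcorner>Fls\<urcorner> v))
      (BAll x (BAll (L 1 x) (body (Imp_code (Var 1) (Var 0)) (Var 1) (Var 0) (L 2 v) (L 2 x))))"
    unfolding Valuation_def body_def ..
  have 1: "EA \<turnstile> Imp (BAll x (BAll (L 1 x) (body (Imp_code (Var 1) (Var 0)) (Var 1) (Var 0) (L 2 v) (L 2 x))))
      (Imp (Le \<ulcorner>A\<urcorner> x) (BAll x (body (Imp_code \<ulcorner>A\<urcorner> (Var 0)) \<ulcorner>A\<urcorner> (Var 0) (L 1 v) (L 1 x))))"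
    using proves_BAll_elim[of EA x "BAll (L 1 x) (body (Imp_code (Var 1) (Var 0)) (Var 1) (Var 0) (L 2 v) (L 2 x))" "\<ulcorner>A\<urcorner>"]
    by (simp add: subst_body numeral_2_eq_2)
  have 2: "EA \<turnstile> Imp (BAll x (body (Imp_code \<ulcorner>A\<urcorner> (Var 0)) \<ulcorner>A\<urcorner> (Var 0) (L 1 v) (L 1 x)))
      (Imp (Le \<ulcorner>B\<urcorner> x) (body ?c \<ulcorner>A\<urcorner> \<ulcorner>B\<urcorner> v x))"
    using proves_BAll_elim[of EA x "body (Imp_code \<ulcorner>A\<urcorner> (Var 0)) \<ulcorner>A\<urcorner> (Var 0) (L 1 v) (L 1 x)" "\<ulcorner>B\<urcorner>"]
    by (simp add: subst_body)
  have 3: "EA \<turnstile> Imp (Eq ?c \<ulcorner>Imp A B\<urcorner>) (Imp (body ?c \<ulcorner>A\<urcorner> \<ulcorner>B\<urcorner> v x) (body \<ulcorner>Imp A B\<urcorner> \<ulcorner>A\<urcorner> \<ulcorner>B\<urcorner> v x))"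
    using proves_Eq_subst[of EA ?c "\<ulcorner>Imp A B\<urcorner>" Var "body (Var 0) \<ulcorner>A\<urcorner> \<ulcorner>B\<urcorner> (lift_tm v) (lift_tm x)"]
    by (simp add: subst_body)
  have le: "EA \<turnstile> Imp (Le (nm p) x) (Le \<ulcorner>C\<urcorner> x)" if "gn C \<le> p" for C
    unfolding quote_fm_def using that by (rule EA_Le_mono)
  have "w (Imp (Le (nm p) x) (Le \<ulcorner>C\<urcorner> x))" if "C = A \<or> C = B \<or> C = Imp A B" for C
    using that w(2)[OF le] p gn_Imp_le[OF p] by blast
  then show "w (Imp (Valuation v x) (Imp (Le (nm p) x)
      (Iff (Mem \<ulcorner>Imp A B\<urcorner> v) (Imp (Mem \<ulcorner>A\<urcorner> v) (Mem \<ulcorner>B\<urcorner> v)))))"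
    using w(1) w(2)[OF 1] w(2)[OF 2] w(2)[OF 3] w(2)[OF EA_Imp_code[of A B]]
    unfolding Valuation by (auto simp: body_def[of "\<ulcorner>Imp A B\<urcorner>"])
qed

text \<open>The proved formula is an entry of the coded list. Through this bound
  \<open>x \<ge> p\<close> covers the codes of the subformulas that the clauses of a valuation
  need.\<close>

lemma codes_proof_gn_le: "codes_proof T p A \<Longrightarrow> gn A \<le> p"
  unfolding codes_proof_def using gn_less_list_encode
  by (metis less_imp_le list.set_intros(1))

text \<open>\<open>C\<close> is provable up to \<open>x\<close>, so every admissible valuation makes
  it true and carries truth from \<open>A\<close> to \<open>B\<close>. Abstracting from the form of
  \<open>C\<close> covers the implication and both directions of the equivalence.\<close>

lemma EA_Follows_antimono:
  assumes \<alpha>: "elementary \<alpha>" "fv \<alpha> \<subseteq> {0}"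
    and A: "sentence A" "gn A \<le> p"
    and C: "sentence C" "codes_proof (extension \<alpha>) p C"
    and CAB: "\<And>v x. EA \<turnstile> Imp (Valuation v x) (Imp (Le (nm p) x)
      (Imp (Mem \<ulcorner>C\<urcorner> v) (Imp (Mem \<ulcorner>A\<urcorner> v) (Mem \<ulcorner>B\<urcorner> v))))"
  shows "EA \<turnstile> Imp (Le (nm p) x) (Imp (Follows \<alpha> x \<ulcorner>B\<urcorner> b) (Follows \<alpha> x \<ulcorner>A\<urcorner> b))"
proof -
  let ?x = "L 1 x"
  let ?T = "BAll ?x (Imp (Conj (Sent (Var 0)) (Box \<alpha> (L 2 x) (Var 0))) (Mem (Var 0) (Var 1)))"
  let ?M = "\<lambda>A. Imp (Conj (Valuation (Var 0) ?x) (Conj (Mem (L 1 \<ulcorner>A\<urcorner>) (Var 0)) ?T)) (Mem (L 1 b) (Var 0))"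
  have "EA \<turnstile> Imp (Le (nm p) ?x) (Imp (?M B) (?M A))"
  proof (rule proves_by_valuation)
    fix w assume w: "valuation w" "\<And>B. EA \<turnstile> B \<Longrightarrow> w B"
    have "EA \<turnstile> Imp ?T (Imp (Le \<ulcorner>C\<urcorner> ?x) (Imp (Conj (Sent \<ulcorner>C\<urcorner>) (Box \<alpha> ?x \<ulcorner>C\<urcorner>)) (Mem \<ulcorner>C\<urcorner> (Var 0))))"
      using proves_BAll_elim[of EA ?x "Imp (Conj (Sent (Var 0)) (Box \<alpha> (L 2 x) (Var 0))) (Mem (Var 0) (Var 1))" "\<ulcorner>C\<urcorner>"]
      by (simp add: subst_Box[OF \<alpha>(2)] numeral_2_eq_2)
    from w(2)[OF this] w(2)[OF EA_Sent[OF C(1)]] w(2)[OF EA_Box[OF \<alpha> C(2), of ?x]]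
      w(2)[OF EA_Le_mono[OF codes_proof_gn_le[OF C(2)], of ?x]] w(2)[OF CAB[of "Var 0" ?x]]
    show "w (Imp (Le (nm p) ?x) (Imp (?M B) (?M A)))"
      using w(1) by (auto simp: quote_fm_def[of C])
  qed
  then have "EA \<turnstile> Imp (Le (nm p) x) (Imp (BAll (Exp2 (Succ x)) (?M B)) (BAll (Exp2 (Succ x)) (?M A)))"
    by (intro proves_BAll_mono) (simp add: lift_tm_def)
  \<comment> \<open>These supply the side conditions on \<open>A\<close>; those on \<open>b\<close>
    come from the premise.\<close>
  moreover note EA_Sent[OF A(1)] EA_Le_mono[OF A(2), of x, folded quote_fm_def]
  ultimately show ?thesis
    unfolding Follows_def by (rule proves_consequence3) simp
qed

text \<open>The intermediate sentence is kept, as only the consequence conjunct depends on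
  \<open>A\<close> and \<open>B\<close>.\<close>

lemma EA_Black_box_antimono:
  assumes \<alpha>: "elementary \<alpha>" "fv \<alpha> \<subseteq> {0}"
    and A: "sentence A" "gn A \<le> p"
    and C: "sentence C" "codes_proof (extension \<alpha>) p C"
    and CAB: "\<And>v x. EA \<turnstile> Imp (Valuation v x) (Imp (Le (nm p) x)
      (Imp (Mem \<ulcorner>C\<urcorner> v) (Imp (Mem \<ulcorner>A\<urcorner> v) (Mem \<ulcorner>B\<urcorner> v))))"
  shows "EA \<turnstile> Imp (Le (nm p) x) (Imp (Black_box \<alpha> \<ulcorner>B\<urcorner> x y) (Black_box \<alpha> \<ulcorner>A\<urcorner> x y))"
proof -
  let ?F = "\<lambda>A. Follows \<alpha> (L 1 x) (L 1 \<ulcorner>A\<urcorner>) (Var 0)"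
  let ?B = "Box_from \<alpha> (Var 0) (L 1 x) (L 1 y)"
  have "EA \<turnstile> Imp (Le (nm p) (L 1 x)) (Imp (?F B) (?F A))"
    using EA_Follows_antimono[OF assms, of "L 1 x" "Var 0"] by simp
  then have "EA \<turnstile> Imp (Le (nm p) (L 1 x)) (Imp (Conj (?F B) ?B) (Conj (?F A) ?B))"
    by (rule proves_consequence) simp
  then show ?thesis
    unfolding Black_box_def by (intro proves_BEx_mono) (simp add: lift_tm_def)
qed

text \<open>Under the bounded quantifier for \<chi>, the outer variable \<open>x\<close> is
  \<open>Var 1\<close>.\<close>

lemma proves_All_Le_BAll:
  assumes "T \<turnstile> Imp (Le (nm p) (Var 1)) A"
  shows "T \<turnstile> All (Imp (Le (nm p) (Var 0)) (BAll (Var 0) A))"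
  using assms by (intro proves_gen proves_BAll_intro) simp

theorem theorem4p3:
  fixes \<A> :: "fm set" and \<alpha> \<phi> \<psi> :: fm and p :: nat
  assumes axioms: "\<forall>A \<in> \<A>. sentence A"
    and alpha: "elementary \<alpha>" "fv \<alpha> \<subseteq> {0}" "binumerates \<A> \<alpha> \<A>"
    and consistent: "\<not> \<A> \<turnstile> Fls"
    and extends_PA: "\<forall>A \<in> PA. \<A> \<turnstile> A"
    and verifiably_extends_PA: "EA \<turnstile> All (Imp (Prov PA_axiom (Var 0)) (Prov \<alpha> (Var 0)))"
    and sentences: "sentence \<phi>" "sentence \<psi>"
  shows "(codes_proof \<A> p (Imp \<phi> \<psi>) \<longrightarrow>
           EA \<turnstile> All (Imp (Le (nm p) (Var 0)) (BAll (Var 0)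
             (Imp (Black_box \<alpha> \<ulcorner>\<psi>\<urcorner> (Var 1) (Var 0)) (Black_box \<alpha> \<ulcorner>\<phi>\<urcorner> (Var 1) (Var 0)))))) \<and>
         (codes_proof \<A> p (Iff \<phi> \<psi>) \<longrightarrow>
           EA \<turnstile> All (Imp (Le (nm p) (Var 0)) (BAll (Var 0)
             (Iff (Black_box \<alpha> \<ulcorner>\<psi>\<urcorner> (Var 1) (Var 0)) (Black_box \<alpha> \<ulcorner>\<phi>\<urcorner> (Var 1) (Var 0))))))"
proof (intro conjI impI)
  \<comment> \<open>Hence a proof from \<open>\<A>\<close> is one in the sense that
    \<open>Prf\<close> expresses in the standard model.\<close>
  have ext: "extension \<alpha> = \<A>"
    using extension_binumeration[OF alpha consistent extends_PA] .
  {
    assume p: "codes_proof \<A> p (Imp \<phi> \<psi>)"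
    note bound = codes_proof_gn_le[OF p]
    have "EA \<turnstile> Imp (Valuation v x) (Imp (Le (nm p) x)
        (Imp (Mem \<ulcorner>Imp \<phi> \<psi>\<urcorner> v) (Imp (Mem \<ulcorner>\<phi>\<urcorner> v) (Mem \<ulcorner>\<psi>\<urcorner> v))))" for v x
      by (rule proves_consequence[OF EA_Valuation_Imp[OF bound, of v x]]) simp
    moreover have "sentence (Imp \<phi> \<psi>)" "gn \<phi> \<le> p"
      using sentences gn_Imp_le[OF bound] by (simp_all add: sentence_def)
    ultimately have "EA \<turnstile> Imp (Le (nm p) (Var 1))
        (Imp (Black_box \<alpha> \<ulcorner>\<psi>\<urcorner> (Var 1) (Var 0)) (Black_box \<alpha> \<ulcorner>\<phi>\<urcorner> (Var 1) (Var 0)))"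
      using EA_Black_box_antimono[OF alpha(1,2) sentences(1)] p ext by blast
    then show "EA \<turnstile> All (Imp (Le (nm p) (Var 0)) (BAll (Var 0)
        (Imp (Black_box \<alpha> \<ulcorner>\<psi>\<urcorner> (Var 1) (Var 0)) (Black_box \<alpha> \<ulcorner>\<phi>\<urcorner> (Var 1) (Var 0)))))"
      by (rule proves_All_Le_BAll)
  }
  assume p: "codes_proof \<A> p (Iff \<phi> \<psi>)"
  have Iff: "Iff \<phi> \<psi> = Imp (Imp (Imp \<phi> \<psi>) (Imp (Imp \<psi> \<phi>) Fls)) Fls"
    by (simp add: Iff_def Conj_def Neg_def)
  \<comment> \<open>The equivalence consists of nested implications; each bound permits the
    valuation clause for one of the five.\<close>
  have bound1: "gn (Imp (Imp (Imp \<phi> \<psi>) (Imp (Imp \<psi> \<phi>) Fls)) Fls) \<le> p"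
    using codes_proof_gn_le[OF p] unfolding Iff .
  have bound2: "gn (Imp (Imp \<phi> \<psi>) (Imp (Imp \<psi> \<phi>) Fls)) \<le> p"
    using gn_Imp_le[OF bound1] by blast
  have bound3: "gn (Imp \<phi> \<psi>) \<le> p" "gn (Imp (Imp \<psi> \<phi>) Fls) \<le> p"
    using gn_Imp_le[OF bound2] by blast+
  have bound4: "gn (Imp \<psi> \<phi>) \<le> p"
    using gn_Imp_le[OF bound3(2)] by blast
  have iff: "EA \<turnstile> Imp (Valuation v x) (Imp (Le (nm p) x)
      (Imp (Mem \<ulcorner>Iff \<phi> \<psi>\<urcorner> v) (Iff (Mem \<ulcorner>\<phi>\<urcorner> v) (Mem \<ulcorner>\<psi>\<urcorner> v))))" for v x
  proof (rule proves_by_valuation)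
    fix w assume w: "valuation w" "\<And>B. EA \<turnstile> B \<Longrightarrow> w B"
    show "w (Imp (Valuation v x) (Imp (Le (nm p) x)
        (Imp (Mem \<ulcorner>Iff \<phi> \<psi>\<urcorner> v) (Iff (Mem \<ulcorner>\<phi>\<urcorner> v) (Mem \<ulcorner>\<psi>\<urcorner> v)))))"
      using w(1) w(2)[OF EA_Valuation_Fls[of v x]] w(2)[OF EA_Valuation_Imp[OF bound1, of v x]]
        w(2)[OF EA_Valuation_Imp[OF bound2, of v x]] w(2)[OF EA_Valuation_Imp[OF bound3(1), of v x]]
        w(2)[OF EA_Valuation_Imp[OF bound3(2), of v x]] w(2)[OF EA_Valuation_Imp[OF bound4, of v x]]
      by (auto simp: Iff)
  qed
  have "EA \<turnstile> Imp (Valuation v x) (Imp (Le (nm p) x)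
      (Imp (Mem \<ulcorner>Iff \<phi> \<psi>\<urcorner> v) (Imp (Mem \<ulcorner>\<phi>\<urcorner> v) (Mem \<ulcorner>\<psi>\<urcorner> v))))"
    "EA \<turnstile> Imp (Valuation v x) (Imp (Le (nm p) x)
      (Imp (Mem \<ulcorner>Iff \<phi> \<psi>\<urcorner> v) (Imp (Mem \<ulcorner>\<psi>\<urcorner> v) (Mem \<ulcorner>\<phi>\<urcorner> v))))" for v x
    by (rule proves_consequence[OF iff[of v x]], simp)+
  moreover have "sentence (Iff \<phi> \<psi>)" "gn \<phi> \<le> p" "gn \<psi> \<le> p"
    using sentences gn_Imp_le[OF bound4] by (simp_all add: sentence_def Iff)
  ultimately have "EA \<turnstile> Imp (Le (nm p) (Var 1))
      (Imp (Black_box \<alpha> \<ulcorner>\<psi>\<urcorner> (Var 1) (Var 0)) (Black_box \<alpha> \<ulcorner>\<phi>\<urcorner> (Var 1) (Var 0)))"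
    "EA \<turnstile> Imp (Le (nm p) (Var 1))
      (Imp (Black_box \<alpha> \<ulcorner>\<phi>\<urcorner> (Var 1) (Var 0)) (Black_box \<alpha> \<ulcorner>\<psi>\<urcorner> (Var 1) (Var 0)))"
    \<comment> \<open>The lemma is used twice, with \<phi> and \<psi> interchanged and the same
      \<open>C\<close>.\<close>
    using EA_Black_box_antimono[OF alpha(1,2) sentences(1)]
      EA_Black_box_antimono[OF alpha(1,2) sentences(2)] p ext by blast+
  then have "EA \<turnstile> Imp (Le (nm p) (Var 1))
      (Iff (Black_box \<alpha> \<ulcorner>\<psi>\<urcorner> (Var 1) (Var 0)) (Black_box \<alpha> \<ulcorner>\<phi>\<urcorner> (Var 1) (Var 0)))"
    by (rule proves_consequence2) auto
  then show "EA \<turnstile> All (Imp (Le (nm p) (Var 0)) (BAll (Var 0)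
      (Iff (Black_box \<alpha> \<ulcorner>\<psi>\<urcorner> (Var 1) (Var 0)) (Black_box \<alpha> \<ulcorner>\<phi>\<urcorner> (Var 1) (Var 0)))))"
    by (rule proves_All_Le_BAll)
qed

end
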